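(* Let $(M,d,\ell)$ be a $\mathcal K$-globally hyperbolic regular Lorentzian geodesic space on which $\ell_-:=\max\{-\ell,0\}$ is continuous. Then: (i) Every $\ell$-path becomes an $\ell$-curve (hence $\ell$-minimizing) after a continuous increasing (not necessarily Lipschitz) reparameterization. (ii) Conversely, any $\ell$-minimizing curve with timelike separated endpoints becomes an $\ell$-path after a similar (continuous increasing) reparameterization.
   Context: A metric spacetime $(M,d,\ell)$ is a metric space $(M,d)$ (with its metric topology) with a time-separation function, i.e. a function $\ell:M^2\to[-\infty,0]\cup\{\infty\}$ with $\ell(x,x)\le0$ for all $x$ and $\ell(x,z)\le\ell(x,y)+\ell(y,z)$ whenever $\max\{\ell(x,y),\ell(y,z)\}<\infty$. Write $x\le y$ if $\ell(x,y)\le0$ and $x\ll y$ (timelike separated) if $\ell(x,y)<0$; $M^2_\le=\{\ell\le0\}$, $M^2_\ll=\{\ell<0\}$. For $X,Y\subset M$, $J(X,Y)$ is the set of $z$ with $x\le z\le y$ for some $x\in X$, $y\in Y$. A path $\sigma:A\to M$ on an interval $A\subset\mathbb R$ (no continuity assumed) is causal if $\ell(\sigma(s),\sigma(t))\le0$ for all $s<t$ in $A$; timelike if the inequality is always strict; lightlike (null) if equality always holds. A causal curve is a nonconstant causal path that is locally Lipschitz with respect to $d$. For a causal path $\sigma:[a,b]\to M$, $L_\ell(\sigma):=\sup\{\sum_{i=1}^N\ell(\sigma(s_{i-1}),\sigma(s_i)) : N\in\mathbb N,\ a=s_0<\dots<s_N=b\}$; $L_d$ is defined by the same formula with $d$ in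 place of $\ell$. An $\ell$-path is a map $\sigma:[0,1]\to M$ (not assumed continuous) with $\ell(\sigma(s),\sigma(t))=(t-s)\ell(\sigma(0),\sigma(1))\notin\{0,\pm\infty\}$ for all $0\le s<t\le1$. An $\ell$-curve is a causal curve $\sigma:[0,1]\to M$ with $L_\ell(\sigma)=\ell(\sigma(0),\sigma(1))$. A causal curve is $\ell$-minimizing if it minimizes $L_\ell$ among all causal curves sharing its endpoints. A metric spacetime is non-totally imprisoning if for each compact subset there is a uniform bound on the $d$-lengths $L_d$ of the causal curves it contains; it is $\mathcal K$-globally hyperbolic if, in addition, $J(X,Y)$ is compact for all compact $X,Y\subset M$. A Lorentzian geodesic space is a metric spacetime in which $\ell_-$ is lower semicontinuous and each $(x,y)\in M^2_\le$ with $x\ne y$ is linked by an $\ell$-curve from $x$ to $y$. A metric spacetime is regular if no $\ell$-minimizing curve $\sigma$ with $\ell(\sigma(0),\sigma(1))<0$ contains a nonconstant lightlike subsegment. Reparameterization convention: reparameterization eliminates any parameter intervals on which a curve is constant. That is, in (ii) a curve $\sigma$ becomes the path $\gamma$ when $\sigma=\gamma\circ\varphi$ for a continuous nondecreasing surjection $\varphi$ of parameter intervals. *)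

theory Defs
  imports "HOL-Analysis.Analysis"
begin

text \<open>
  The metric space \<open>(M, d)\<close> is the whole type \<open>'a::metric_space\<close> with \<open>dist\<close>; the time separation
  is a function \<open>l\<close> with extended real values, timelike related pairs having \<open>l x y < 0\<close> and causally
  unrelated pairs having \<open>l x y = \<infinity>\<close>. Paths are total functions on the reals of which only the values
  on the stated parameter interval matter.
\<close>

definition metric_spacetime :: "('a::metric_space \<Rightarrow> 'a \<Rightarrow> ereal) \<Rightarrow> bool" where
  "metric_spacetime l \<longleftrightarrow>
     (\<forall>x y. l x y \<le> 0 \<or> l x y = \<infinity>) \<and>
     (\<forall>x. l x x \<le> 0) \<and>
     (\<forall>x y z. max (l x y) (l y z) < \<infinity> \<longrightarrow> l x z \<le> l x y + l y z)"

definition neg_part :: "('a \<Rightarrow> 'a \<Rightarrow> ereal) \<Rightarrow> 'a \<times> 'a \<Rightarrow> ereal" where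
  "neg_part l = (\<lambda>(x, y). max (- l x y) 0)"

definition J :: "('a \<Rightarrow> 'a \<Rightarrow> ereal) \<Rightarrow> 'a set \<Rightarrow> 'a set \<Rightarrow> 'a set" where
  "J l X Y = {z. \<exists>x\<in>X. \<exists>y\<in>Y. l x z \<le> 0 \<and> l z y \<le> 0}"

definition causal_path :: "('a \<Rightarrow> 'a \<Rightarrow> ereal) \<Rightarrow> real set \<Rightarrow> (real \<Rightarrow> 'a) \<Rightarrow> bool" where
  "causal_path l A \<sigma> \<longleftrightarrow>
     is_interval A \<and> (\<forall>s\<in>A. \<forall>t\<in>A. s < t \<longrightarrow> l (\<sigma> s) (\<sigma> t) \<le> 0)"

definition lightlike_path :: "('a \<Rightarrow> 'a \<Rightarrow> ereal) \<Rightarrow> real set \<Rightarrow> (real \<Rightarrow> 'a) \<Rightarrow> bool" where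
  "lightlike_path l A \<sigma> \<longleftrightarrow>
     is_interval A \<and> (\<forall>s\<in>A. \<forall>t\<in>A. s < t \<longrightarrow> l (\<sigma> s) (\<sigma> t) = 0)"

definition locally_lipschitz_on :: "real set \<Rightarrow> (real \<Rightarrow> 'a::metric_space) \<Rightarrow> bool" where
  "locally_lipschitz_on A \<sigma> \<longleftrightarrow> (\<forall>t\<in>A. \<exists>u>0. \<exists>C. C-lipschitz_on (cball t u \<inter> A) \<sigma>)"

definition causal_curve :: "('a::metric_space \<Rightarrow> 'a \<Rightarrow> ereal) \<Rightarrow> real set \<Rightarrow> (real \<Rightarrow> 'a) \<Rightarrow> bool" where
  "causal_curve l A \<sigma> \<longleftrightarrow>
     causal_path l A \<sigma> \<and> \<not> \<sigma> constant_on A \<and> locally_lipschitz_on A \<sigma>"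

text \<open>
  The common formula for the two lengths; \<open>N = 0\<close> is possible only if \<open>a = b\<close>.
\<close>

definition path_length_wrt ::
  "('a \<Rightarrow> 'a \<Rightarrow> ereal) \<Rightarrow> real \<Rightarrow> real \<Rightarrow> (real \<Rightarrow> 'a) \<Rightarrow> ereal" where
  "path_length_wrt f a b \<sigma> =
     Sup {(\<Sum>i<N. f (\<sigma> (s i)) (\<sigma> (s (Suc i)))) | (N::nat) (s::nat \<Rightarrow> real).
            s 0 = a \<and> s N = b \<and> (\<forall>i<N. s i < s (Suc i))}"

abbreviation L_time :: "('a \<Rightarrow> 'a \<Rightarrow> ereal) \<Rightarrow> real \<Rightarrow> real \<Rightarrow> (real \<Rightarrow> 'a) \<Rightarrow> ereal" where
  "L_time l a b \<sigma> \<equiv> path_length_wrt l a b \<sigma>"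

abbreviation L_dist :: "real \<Rightarrow> real \<Rightarrow> (real \<Rightarrow> 'a::metric_space) \<Rightarrow> ereal" where
  "L_dist a b \<sigma> \<equiv> path_length_wrt (\<lambda>x y. ereal (dist x y)) a b \<sigma>"

definition l_path :: "('a \<Rightarrow> 'a \<Rightarrow> ereal) \<Rightarrow> (real \<Rightarrow> 'a) \<Rightarrow> bool" where
  "l_path l \<sigma> \<longleftrightarrow>
     (\<forall>s t. 0 \<le> s \<and> s < t \<and> t \<le> 1 \<longrightarrow>
        l (\<sigma> s) (\<sigma> t) = ereal (t - s) * l (\<sigma> 0) (\<sigma> 1) \<and>
        l (\<sigma> s) (\<sigma> t) \<notin> {0, \<infinity>, -\<infinity>})"

definition l_curve :: "('a::metric_space \<Rightarrow> 'a \<Rightarrow> ereal) \<Rightarrow> (real \<Rightarrow> 'a) \<Rightarrow> bool" where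
  "l_curve l \<sigma> \<longleftrightarrow> causal_curve l {0..1} \<sigma> \<and> L_time l 0 1 \<sigma> = l (\<sigma> 0) (\<sigma> 1)"

definition l_minimizing ::
  "('a::metric_space \<Rightarrow> 'a \<Rightarrow> ereal) \<Rightarrow> real \<Rightarrow> real \<Rightarrow> (real \<Rightarrow> 'a) \<Rightarrow> bool" where
  "l_minimizing l a b \<sigma> \<longleftrightarrow>
     causal_curve l {a..b} \<sigma> \<and>
     (\<forall>c d \<tau>. causal_curve l {c..d} \<tau> \<and> \<tau> c = \<sigma> a \<and> \<tau> d = \<sigma> b
        \<longrightarrow> L_time l a b \<sigma> \<le> L_time l c d \<tau>)"

definition non_totally_imprisoning :: "('a::metric_space \<Rightarrow> 'a \<Rightarrow> ereal) \<Rightarrow> bool" where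
  "non_totally_imprisoning l \<longleftrightarrow>
     (\<forall>K. compact K \<longrightarrow>
        (\<exists>C::real. \<forall>a b \<sigma>. causal_curve l {a..b} \<sigma> \<and> \<sigma> ` {a..b} \<subseteq> K
            \<longrightarrow> L_dist a b \<sigma> \<le> ereal C))"

definition K_globally_hyperbolic :: "('a::metric_space \<Rightarrow> 'a \<Rightarrow> ereal) \<Rightarrow> bool" where
  "K_globally_hyperbolic l \<longleftrightarrow>
     non_totally_imprisoning l \<and>
     (\<forall>X Y. compact X \<and> compact Y \<longrightarrow> compact (J l X Y))"

definition lower_semicontinuous :: "('b::topological_space \<Rightarrow> ereal) \<Rightarrow> bool" where
  "lower_semicontinuous f \<longleftrightarrow> (\<forall>p. \<forall>c < f p. \<forall>\<^sub>F q in nhds p. c < f q)"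

definition lorentzian_geodesic_space :: "('a::metric_space \<Rightarrow> 'a \<Rightarrow> ereal) \<Rightarrow> bool" where
  "lorentzian_geodesic_space l \<longleftrightarrow>
     metric_spacetime l \<and>
     lower_semicontinuous (neg_part l) \<and>
     (\<forall>x y. l x y \<le> 0 \<and> x \<noteq> y \<longrightarrow> (\<exists>\<sigma>. l_curve l \<sigma> \<and> \<sigma> 0 = x \<and> \<sigma> 1 = y))"

definition regular_spacetime :: "('a::metric_space \<Rightarrow> 'a \<Rightarrow> ereal) \<Rightarrow> bool" where
  "regular_spacetime l \<longleftrightarrow>
     (\<forall>\<sigma>. l_minimizing l 0 1 \<sigma> \<and> l (\<sigma> 0) (\<sigma> 1) < 0 \<longrightarrow>
        \<not> (\<exists>s t. 0 \<le> s \<and> s < t \<and> t \<le> 1 \<and>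
               lightlike_path l {s..t} \<sigma> \<and> \<not> \<sigma> constant_on {s..t}))"

text \<open>
  \<open>\<sigma>\<close> on \<open>{a..b}\<close> becomes \<open>\<gamma>\<close> on \<open>{c..d}\<close> through \<open>\<phi>\<close>. Since \<open>\<phi>\<close> is only nondecreasing, intervals
  on which \<open>\<sigma>\<close> is constant may be eliminated.
\<close>

definition reparameterizes ::
  "(real \<Rightarrow> real) \<Rightarrow> real \<Rightarrow> real \<Rightarrow> (real \<Rightarrow> 'a) \<Rightarrow> real \<Rightarrow> real \<Rightarrow> (real \<Rightarrow> 'a) \<Rightarrow> bool" where
  "reparameterizes \<phi> a b \<sigma> c d \<gamma> \<longleftrightarrow>
     continuous_on {a..b} \<phi> \<and> mono_on {a..b} \<phi> \<and> \<phi> ` {a..b} = {c..d} \<and>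
     (\<forall>t\<in>{a..b}. \<sigma> t = \<gamma> (\<phi> t))"

end

theory Submission
  imports Defs
begin

text \<open>
  Curves are compared with polygons of \<open>l\<close>-curves through prescribed causal chains. If a chain is
  additive for \<open>l\<close>, the polygon is minimizing, so by regularity it cannot contain a nonconstant null
  edge. A limit point of an \<open>l\<close>-path at a discontinuity would produce such an edge, hence \<open>l\<close>-paths
  are continuous; and since the polygons inscribed in the path are causal curves in a compact
  diamond, whose \<open>d\<close>-lengths are bounded, an \<open>l\<close>-path is rectifiable and its arclength parameter makes
  it Lipschitz. Conversely, along a minimizing curve \<open>\<sigma>\<close> the function \<open>t \<mapsto> l(\<sigma>(a), \<sigma>(t))\<close> is
  additive and continuous, and by regularity it is stationary only where \<open>\<sigma>\<close> is constant, so it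
  serves (after normalization) as the new parameter.
\<close>

text \<open>Since \<open>l\<close> is nonpositive on causal pairs and lengths are suprema, every
  curve is at least as long as the separation of its endpoints. Minimality therefore amounts to
  equality in the triangle inequality along the curve, and it is certified by a real potential whose
  increments bound the separations. Three obstacles shape the argument. Regularity speaks only of
  Lipschitz minimizers, while an \<open>l\<close>-path is not even known to be continuous; hence
  chains of its points and limit points have to be turned into Lipschitz curves before regularity
  says anything. The negative part vanishes both on null and on unrelated pairs, so its continuity
  does not make limits of causal pairs causal; compactness of diamonds does. Finally
  \<open>l\<close> may be -\<infinity>, so nothing can be subtracted before finiteness is known: it
  is inherited by all pairs between two points of finite separation, but needs its own argument for
  a minimizing curve.\<close>

section \<open>Partition sums, lengths and Lipschitz maps on intervals\<close>

lemma chain_le: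
  fixes s :: "nat \<Rightarrow> real"
  assumes "\<And>i. i < N \<Longrightarrow> s i \<le> s (Suc i)" "i \<le> j" "j \<le> N"
  shows "s i \<le> s j"
  using assms(2,3)
proof (induction j rule: dec_induct)
  case (step k)
  then show ?case using assms(1)[of k] by simp
qed simp

lemma path_length_ge:
  assumes "s 0 = a" "s N = b" "\<And>i. i < N \<Longrightarrow> s i < s (Suc i)"
  shows "(\<Sum>i<N. f (\<sigma> (s i)) (\<sigma> (s (Suc i)))) \<le> path_length_wrt f a b \<sigma>"
  unfolding path_length_wrt_def
  by (rule Sup_upper) (use assms in blast)

text \<open>A repeated partition point contributes a term that is at most 0, so deleting it can only
  raise the sum. This spares later chains a case distinction for coinciding parameters.\<close>

lemma path_length_ge_weak:
  fixes p :: "nat \<Rightarrow> real"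
  assumes "\<And>i. i < N \<Longrightarrow> p i \<le> p (Suc i)"
    and "\<And>i. i < N \<Longrightarrow> f (\<sigma> (p i)) (\<sigma> (p i)) \<le> 0"
  shows "(\<Sum>i<N. f (\<sigma> (p i)) (\<sigma> (p (Suc i)))) \<le> path_length_wrt f (p 0) (p N) \<sigma>"
proof -
  have "\<exists>n q. q 0 = p 0 \<and> q n = p N \<and> (\<forall>i<n. q i < q (Suc i)) \<and>
     (\<Sum>i<N. f (\<sigma> (p i)) (\<sigma> (p (Suc i)))) \<le> (\<Sum>i<n. f (\<sigma> (q i)) (\<sigma> (q (Suc i))))"
    using assms
  proof (induction N)
    case 0
    show ?case by (rule exI[of _ 0], rule exI[of _ p]) simp
  next
    case (Suc N)
    obtain n q where q: "q 0 = p 0" "q n = p N" "\<forall>i<n. q i < q (Suc i)"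
      "(\<Sum>i<N. f (\<sigma> (p i)) (\<sigma> (p (Suc i)))) \<le> (\<Sum>i<n. f (\<sigma> (q i)) (\<sigma> (q (Suc i))))"
      using Suc.IH[OF Suc.prems] less_SucI by blast
    show ?case
    proof (cases "p N = p (Suc N)")
      case True
      have "f (\<sigma> (p N)) (\<sigma> (p (Suc N))) \<le> 0" using Suc.prems(2)[of N] True by simp
      then have "(\<Sum>i<Suc N. f (\<sigma> (p i)) (\<sigma> (p (Suc i)))) \<le>
          (\<Sum>i<n. f (\<sigma> (q i)) (\<sigma> (q (Suc i)))) + 0"
        unfolding sum.lessThan_Suc using q(4) by (intro add_mono)
      then show ?thesis using q True by (intro exI[of _ n] exI[of _ q]) auto
    next
      case False
      then have lt: "p N < p (Suc N)" using Suc.prems(1)[of N] by simp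
      define q' where "q' = q(Suc n := p (Suc N))"
      have "(\<Sum>i<n. f (\<sigma> (q' i)) (\<sigma> (q' (Suc i)))) = (\<Sum>i<n. f (\<sigma> (q i)) (\<sigma> (q (Suc i))))"
        by (rule sum.cong) (auto simp: q'_def)
      then have "(\<Sum>i<Suc N. f (\<sigma> (p i)) (\<sigma> (p (Suc i)))) \<le>
          (\<Sum>i<Suc n. f (\<sigma> (q' i)) (\<sigma> (q' (Suc i))))"
        using q(2,4) by (simp add: q'_def add_right_mono)
      moreover have "\<forall>i<Suc n. q' i < q' (Suc i)"
        using q(2,3) lt by (auto simp: q'_def less_Suc_eq)
      ultimately show ?thesis using q(1)
        by (intro exI[of _ "Suc n"] exI[of _ q']) (auto simp: q'_def)
    qed
  qed
  then obtain n q where q: "q 0 = p 0" "q n = p N" "\<forall>i<n. q i < q (Suc i)"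
     "(\<Sum>i<N. f (\<sigma> (p i)) (\<sigma> (p (Suc i)))) \<le> (\<Sum>i<n. f (\<sigma> (q i)) (\<sigma> (q (Suc i))))"
    by blast
  have "(\<Sum>i<n. f (\<sigma> (q i)) (\<sigma> (q (Suc i)))) \<le> path_length_wrt f (p 0) (p N) \<sigma>"
    by (rule path_length_ge) (use q in auto)
  with q(4) show ?thesis by (rule order_trans)
qed

text \<open>\<open>h\<close> acts as a potential: every partition sum is dominated by the same
  telescoping sum. Upper bounds for the time length of concrete curves are obtained in this
  way.\<close>

lemma path_length_le_telescope:
  assumes "\<And>s t. a \<le> s \<Longrightarrow> s \<le> t \<Longrightarrow> t \<le> b \<Longrightarrow> f (\<sigma> s) (\<sigma> t) \<le> ereal (h t - h s)"
  shows "path_length_wrt f a b \<sigma> \<le> ereal (h b - h a)"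
  unfolding path_length_wrt_def
proof (rule Sup_least, clarify)
  fix N and s :: "nat \<Rightarrow> real"
  assume s: "a = s 0" "b = s N" "\<forall>i<N. s i < s (Suc i)"
  have mono: "s i \<le> s j" if "i \<le> j" "j \<le> N" for i j
    by (rule chain_le[of N]) (use s that in \<open>auto simp: less_imp_le\<close>)
  have "(\<Sum>i<N. f (\<sigma> (s i)) (\<sigma> (s (Suc i)))) \<le> (\<Sum>i<N. ereal (h (s (Suc i)) - h (s i)))"
    by (rule sum_mono, rule assms) (use mono s in auto)
  also have "\<dots> = ereal (h (s N) - h (s 0))"
    by (simp add: sum_lessThan_telescope[of "\<lambda>i. h (s i)"])
  finally show "(\<Sum>i<N. f (\<sigma> (s i)) (\<sigma> (s (Suc i)))) \<le> ereal (h (s N) - h (s 0))" .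
qed

text \<open>Splitting at integers reduces a transitive relation to single unit intervals. It serves
  to carry causality, Lipschitz bounds and additivity from the edges of a polygon to the whole of
  it.\<close>

lemma transitive_on_unit_pieces:
  fixes R :: "real \<Rightarrow> real \<Rightarrow> bool"
  assumes trans: "\<And>s t u. 0 \<le> s \<Longrightarrow> s \<le> t \<Longrightarrow> t \<le> u \<Longrightarrow> u \<le> real N \<Longrightarrow> R s t \<Longrightarrow> R t u \<Longrightarrow> R s u"
    and piece: "\<And>i s t. i < N \<Longrightarrow> real i \<le> s \<Longrightarrow> s \<le> t \<Longrightarrow> t \<le> real (Suc i) \<Longrightarrow> R s t"
    and st: "0 < N" "0 \<le> s" "s \<le> t" "t \<le> real N"
  shows "R s t"
proof -
  have "R s t" if "0 < n" "n \<le> N" "0 \<le> s" "s \<le> t" "t \<le> real n" for n s t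
    using that
  proof (induction n arbitrary: s t)
    case (Suc n)
    consider "real n \<le> s" | "n > 0" "t \<le> real n" | "n > 0" "s \<le> real n" "real n \<le> t"
      using Suc.prems by (cases "n = 0") force+
    then show ?case
    proof cases
      case 1 then show ?thesis using Suc.prems by (intro piece[of n]) auto
    next
      case 2 then show ?thesis using Suc by auto
    next
      case 3
      have "R s (real n)" using 3 Suc by auto
      moreover have "R (real n) t" using 3 Suc.prems by (intro piece[of n]) auto
      ultimately show ?thesis by (rule trans[rotated 4]) (use 3 Suc.prems in auto)
    qed
  qed simp
  then show ?thesis using st by blast
qed

lemma lipschitz_imp_locally_lipschitz:
  "C-lipschitz_on A \<sigma> \<Longrightarrow> locally_lipschitz_on A \<sigma>"
  unfolding locally_lipschitz_on_def
  by (metis inf_le2 lipschitz_on_subset zero_less_one)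

lemma locally_lipschitz_on_compact:
  assumes "locally_lipschitz_on {a..b} \<sigma>"
  obtains C where "C-lipschitz_on {a..b} \<sigma>"
proof -
  \<comment> \<open>The compactness theorem concerns families indexed by time; a constant family
    over a one-point time set specialises it to a single map.\<close>
  have "local_lipschitz {0::real} {a..b} (\<lambda>_. \<sigma>)"
    unfolding local_lipschitz_def
  proof (intro ballI)
    fix t :: real and x assume "x \<in> {a..b}"
    then obtain u C where "u > 0" "C-lipschitz_on (cball x u \<inter> {a..b}) \<sigma>"
      using assms unfolding locally_lipschitz_on_def by blast
    then show "\<exists>u>0. \<exists>L. \<forall>t\<in>cball t u \<inter> {0}. L-lipschitz_on (cball x u \<inter> {a..b}) \<sigma>" by blast
  qed
  then obtain C where "\<And>t. t \<in> {0::real} \<Longrightarrow> C-lipschitz_on {a..b} \<sigma>"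
    using local_lipschitz_compact_implies_lipschitz[of "{0::real}" "{a..b}" "\<lambda>_. \<sigma>"] by auto
  then show ?thesis using that by blast
qed

lemma causal_curve_continuous:
  "causal_curve l {a..b} \<sigma> \<Longrightarrow> continuous_on {a..b} \<sigma>"
  unfolding causal_curve_def
  by (metis lipschitz_on_continuous_on locally_lipschitz_on_compact)

lemma causal_curve_imp_less:
  "causal_curve l {a..b} \<sigma> \<Longrightarrow> a < b"
  unfolding causal_curve_def constant_on_def
  by (metis atLeastAtMost_iff linorder_not_less order.trans order_antisym)

lemma causal_pathI:
  "(\<And>s t. a \<le> s \<Longrightarrow> s < t \<Longrightarrow> t \<le> b \<Longrightarrow> l (\<sigma> s) (\<sigma> t) \<le> 0) \<Longrightarrow> causal_path l {a..b} \<sigma>"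
  by (auto simp: causal_path_def is_interval_cc)

section \<open>Arclength as a parameter\<close>

text \<open>\<open>E a b\<close> is the length of \<open>\<sigma>\<close> on \<open>{a..b}\<close>. As suprema of continuous functions, \<open>E 0 t\<close> and
  \<open>E t 1\<close> are lower semicontinuous in \<open>t\<close>; since they add up to \<open>E 0 1\<close>, both are continuous.\<close>

lemma arclength_gauge:
  fixes \<sigma> :: "real \<Rightarrow> 'a::metric_space"
  assumes cont: "continuous_on {0..1} \<sigma>"
    and bound: "\<And>s N. (\<And>i. 0 \<le> s i \<and> s i \<le> s (Suc i) \<and> s i \<le> 1) \<Longrightarrow>
      (\<Sum>i<N. dist (\<sigma> (s i)) (\<sigma> (s (Suc i)))) \<le> C"
    and inj: "inj_on \<sigma> {0..1}"
  obtains \<phi> D where "continuous_on {0..1} \<phi>" "strict_mono_on {0..1} \<phi>" "\<phi> 0 = 0" "\<phi> 1 = 1"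
    "0 \<le> D"
    "\<And>s t. 0 \<le> s \<Longrightarrow> s \<le> t \<Longrightarrow> t \<le> 1 \<Longrightarrow> dist (\<sigma> s) (\<sigma> t) \<le> D * (\<phi> t - \<phi> s)"
proof -
  define S where "S N s = (\<Sum>i<N. dist (\<sigma> (s i)) (\<sigma> (s (Suc i))))" for N and s :: "nat \<Rightarrow> real"
  \<comment> \<open>Weakly increasing infinite sequences play the role of partitions. They need not
    start at \<open>a\<close> or reach \<open>b\<close>, and clipping all terms by
    \<open>min\<close> or \<open>max\<close> yields such a sequence again.\<close>
  define P where "P a b s \<longleftrightarrow> (\<forall>i. a \<le> s i \<and> s i \<le> s (Suc i) \<and> s i \<le> b)" for a b and s :: "nat \<Rightarrow> real"
  define V where "V a b = {S N s | N s. P a b s}" for a b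
  define E where "E a b = Sup (V a b)" for a b
  have bdd: "bdd_above (V a b)" if "0 \<le> a" "b \<le> 1" for a b
  proof (rule bdd_aboveI)
    fix v assume "v \<in> V a b"
    then obtain N s where s: "v = S N s" "P a b s" by (auto simp: V_def)
    have "S N s \<le> C" unfolding S_def
      by (rule bound) (use s(2) that in \<open>auto simp: P_def intro: order_trans\<close>)
    then show "v \<le> C" using s by simp
  qed
  have S_le_E: "S N s \<le> E a b" if "0 \<le> a" "b \<le> 1" "P a b s" for a b N s
    unfolding E_def by (rule cSup_upper) (use that bdd in \<open>auto simp: V_def\<close>)
  have nonempty: "V a b \<noteq> {}" if "a \<le> b" for a b
  proof -
    have "P a b (\<lambda>_. a)" using that by (simp add: P_def)
    then show ?thesis by (auto simp: V_def)
  qed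
  have E_le: "E a b \<le> c" if "a \<le> b" "\<And>N s. P a b s \<Longrightarrow> S N s \<le> c" for a b c
    unfolding E_def by (rule cSup_least) (use that nonempty in \<open>auto simp: V_def\<close>)
  have dist_le: "dist (\<sigma> a) (\<sigma> b) \<le> E a b" if "0 \<le> a" "a \<le> b" "b \<le> 1" for a b
  proof -
    define s where "s i = (if i = 0 then a else b)" for i :: nat
    have "S 1 s \<le> E a b" by (rule S_le_E) (use that in \<open>auto simp: P_def s_def\<close>)
    then show ?thesis by (simp add: S_def s_def)
  qed
  have super: "E a b + E b c \<le> E a c" if abc: "0 \<le> a" "a \<le> b" "b \<le> c" "c \<le> 1" for a b c
  proof -
    have *: "S N s + S M r \<le> E a c" if "P a b s" "P b c r" for N s M r
    proof -
      \<comment> \<open>The shift by \<open>Suc N\<close> inserts an additional link from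
        \<open>s N\<close> to \<open>r 0\<close>; its length is nonnegative, so it cannot lower the
        sum.\<close>
      define q where "q i = (if i \<le> N then s i else r (i - Suc N))" for i
      have "P a c q" unfolding P_def
      proof
        fix i
        have s: "a \<le> s i" "s i \<le> s (Suc i)" "s i \<le> b" for i using that(1) by (auto simp: P_def)
        have r: "b \<le> r i" "r i \<le> r (Suc i)" "r i \<le> c" for i using that(2) by (auto simp: P_def)
        consider "Suc i \<le> N" | "i = N" | "Suc N \<le> i" by linarith
        then show "a \<le> q i \<and> q i \<le> q (Suc i) \<and> q i \<le> c"
        proof cases
          case 1 then show ?thesis using s[of i] abc by (auto simp: q_def)
        next
          case 2 then show ?thesis using s[of i] r[of 0] abc by (auto simp: q_def)
        next
          case 3
          then have "Suc i - Suc N = Suc (i - Suc N)" by simp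
          then show ?thesis using 3 r[of "i - Suc N"] abc by (auto simp: q_def)
        qed
      qed
      then have "S (Suc N + M) q \<le> E a c" by (intro S_le_E) (use abc in auto)
      moreover have "S (Suc N + M) q = S (Suc N) q + S M r"
        unfolding S_def
        by (induction M) (simp_all add: q_def)
      moreover have "S N s \<le> S (Suc N) q"
      proof -
        have "S N s = S N q" unfolding S_def by (rule sum.cong) (auto simp: q_def)
        then show ?thesis by (simp add: S_def)
      qed
      ultimately show ?thesis by linarith
    qed
    have "E b c \<le> E a c - S N s" if s: "P a b s" for N s
    proof (rule E_le)
      show "S M r \<le> E a c - S N s" if "P b c r" for M r using *[OF s that, of N M] by linarith
    qed fact
    then have "E a b \<le> E a c - E b c"
      by (intro E_le) (use abc in \<open>auto simp: algebra_simps\<close>)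
    then show ?thesis by simp
  qed
  have P_min: "P a b (\<lambda>i. min (s i) b)" if "P a c s" "a \<le> b" for a b c s
    unfolding P_def
  proof (intro allI conjI)
    fix i
    have "a \<le> s i" "s i \<le> s (Suc i)" using that(1) by (auto simp: P_def)
    then show "a \<le> min (s i) b" "min (s i) b \<le> min (s (Suc i)) b" "min (s i) b \<le> b"
      using that(2) by auto
  qed
  have P_max: "P b c (\<lambda>i. max (s i) b)" if "P a c s" "b \<le> c" for a b c s
    unfolding P_def
  proof (intro allI conjI)
    fix i
    have "s i \<le> s (Suc i)" "s i \<le> c" using that(1) by (auto simp: P_def)
    then show "b \<le> max (s i) b" "max (s i) b \<le> max (s (Suc i)) b" "max (s i) b \<le> c"
      using that(2) by auto
  qed
  have sub: "E a c \<le> E a b + E b c" if abc: "0 \<le> a" "a \<le> b" "b \<le> c" "c \<le> 1" for a b c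
  proof (rule E_le)
    fix N s assume s: "P a c s"
    \<comment> \<open>Only a step that straddles \<open>b\<close> uses the triangle inequality; for
      any other step one of the two clipped terms vanishes.\<close>
    have "S N s \<le> S N (\<lambda>i. min (s i) b) + S N (\<lambda>i. max (s i) b)"
      unfolding S_def sum.distrib[symmetric]
    proof (rule sum_mono)
      fix i
      have le: "s i \<le> s (Suc i)" using s by (simp add: P_def)
      consider "s (Suc i) \<le> b" | "b \<le> s i" | "s i \<le> b" "b \<le> s (Suc i)" by linarith
      then show "dist (\<sigma> (s i)) (\<sigma> (s (Suc i))) \<le>
          dist (\<sigma> (min (s i) b)) (\<sigma> (min (s (Suc i)) b)) +
          dist (\<sigma> (max (s i) b)) (\<sigma> (max (s (Suc i)) b))"
        by cases (use le in \<open>auto simp: min_absorb1 min_absorb2 max_absorb1 max_absorb2 dist_triangle\<close>)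
    qed
    also have "\<dots> \<le> E a b + E b c"
      by (intro add_mono S_le_E P_min[OF s] P_max[OF s]) (use abc in auto)
    finally show "S N s \<le> E a b + E b c" .
  qed (use abc in auto)
  have add: "E a c = E a b + E b c" if "0 \<le> a" "a \<le> b" "b \<le> c" "c \<le> 1" for a b c
    using sub[OF that] super[OF that] by simp
  have less_E: "\<exists>N s. P a b s \<and> x < S N s" if "0 \<le> a" "a \<le> b" "b \<le> 1" "x < E a b" for a b x
    using that less_cSup_iff[OF nonempty[of a b] bdd[of a b], of x] by (auto simp: E_def V_def)
  have lsc: "\<forall>\<^sub>F u in at t within {0..1}. x < E 0 u" if t: "0 \<le> t" "t \<le> 1" and x: "x < E 0 t" for t x
  proof -
    \<comment> \<open>One partition whose sum exceeds \<open>x\<close> is frozen and clipped at the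
      variable endpoint \<open>u\<close>: the clipped sum is continuous in \<open>u\<close>, has the
      old value at \<open>u = t\<close>, and is at most \<open>E 0 u\<close>.\<close>
    obtain N s where s: "P 0 t s" "x < S N s" using less_E[OF _ t x] by auto
    have s01: "0 \<le> s i" "s i \<le> t" for i using s(1) by (auto simp: P_def)
    have "continuous_on {0..1} (\<lambda>u. S N (\<lambda>i. min (s i) u))"
      unfolding S_def
      by (intro continuous_intros continuous_on_compose2[OF cont]) (use s01 t in \<open>auto simp: min_le_iff_disj\<close>)
    then have "((\<lambda>u. S N (\<lambda>i. min (s i) u)) \<longlongrightarrow> S N (\<lambda>i. min (s i) t)) (at t within {0..1})"
      using t by (simp add: continuous_on)
    moreover have "S N (\<lambda>i. min (s i) t) = S N s" using s01 by (simp add: min_absorb1)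
    ultimately have "\<forall>\<^sub>F u in at t within {0..1}. x < S N (\<lambda>i. min (s i) u)"
      using s(2) by (intro order_tendstoD(1)) auto
    moreover have "\<forall>\<^sub>F u in at t within {0..1}. u \<in> {0..1}"
      by (rule eventually_at_topological[THEN iffD2]) auto
    ultimately show ?thesis
    proof eventually_elim
      case (elim u)
      have "S N (\<lambda>i. min (s i) u) \<le> E 0 u"
        by (intro S_le_E P_min[OF s(1)]) (use elim in auto)
      then show ?case using elim by simp
    qed
  qed
  have lsc': "\<forall>\<^sub>F u in at t within {0..1}. x < E u 1" if t: "0 \<le> t" "t \<le> 1" and x: "x < E t 1" for t x
  proof -
    obtain N s where s: "P t 1 s" "x < S N s" using less_E[OF t _ x] by auto
    have s01: "t \<le> s i" "s i \<le> 1" for i using s(1) by (auto simp: P_def)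
    have "continuous_on {0..1} (\<lambda>u. S N (\<lambda>i. max (s i) u))"
      unfolding S_def
      by (intro continuous_intros continuous_on_compose2[OF cont]) (use s01 t in \<open>auto simp: le_max_iff_disj\<close>)
    then have "((\<lambda>u. S N (\<lambda>i. max (s i) u)) \<longlongrightarrow> S N (\<lambda>i. max (s i) t)) (at t within {0..1})"
      using t by (simp add: continuous_on)
    moreover have "S N (\<lambda>i. max (s i) t) = S N s" using s01 by (simp add: max_absorb1)
    ultimately have "\<forall>\<^sub>F u in at t within {0..1}. x < S N (\<lambda>i. max (s i) u)"
      using s(2) by (intro order_tendstoD(1)) auto
    moreover have "\<forall>\<^sub>F u in at t within {0..1}. u \<in> {0..1}"
      by (rule eventually_at_topological[THEN iffD2]) auto
    ultimately show ?thesis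
    proof eventually_elim
      case (elim u)
      have "S N (\<lambda>i. max (s i) u) \<le> E u 1"
        by (intro S_le_E P_max[OF s(1)]) (use elim in auto)
      then show ?case using elim by simp
    qed
  qed
  have E_cont: "continuous_on {0..1} (E 0)"
    unfolding continuous_on
  proof (intro ballI order_tendstoI)
    fix t x :: real assume t: "t \<in> {0..1}"
    show "\<forall>\<^sub>F u in at t within {0..1}. x < E 0 u" if "x < E 0 t"
      using lsc t that by auto
    assume "E 0 t < x"
    then have "E 0 1 - x < E t 1" using add[of 0 t 1] t by simp
    then have "\<forall>\<^sub>F u in at t within {0..1}. E 0 1 - x < E u 1" using lsc' t by auto
    moreover have "\<forall>\<^sub>F u in at t within {0..1}. u \<in> {0..1}"
      by (rule eventually_at_topological[THEN iffD2]) auto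
    ultimately show "\<forall>\<^sub>F u in at t within {0..1}. E 0 u < x"
    proof eventually_elim
      case (elim u)
      then show ?case using add[of 0 u 1] by simp
    qed
  qed
  have pos: "0 < E s t" if "0 \<le> s" "s < t" "t \<le> 1" for s t
  proof -
    have "\<sigma> s \<noteq> \<sigma> t" using inj_onD[OF inj, of s t] that by auto
    then have "0 < dist (\<sigma> s) (\<sigma> t)" by simp
    also have "\<dots> \<le> E s t" by (rule dist_le) (use that in auto)
    finally show ?thesis .
  qed
  then have pos1: "0 < E 0 1" by simp
  show ?thesis
  \<comment> \<open>The parameter is arclength divided by the total length, which is positive by
    injectivity; \<open>D\<close> is the total length.\<close>
  proof (rule that[of "\<lambda>t. E 0 t / E 0 1" "E 0 1"])
    show "continuous_on {0..1} (\<lambda>t. E 0 t / E 0 1)"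
      using E_cont pos1 by (intro continuous_intros) auto
    show "strict_mono_on {0..1} (\<lambda>t. E 0 t / E 0 1)"
    proof (rule strict_mono_onI)
      fix s t :: real assume "s \<in> {0..1}" "t \<in> {0..1}" "s < t"
      then show "E 0 s / E 0 1 < E 0 t / E 0 1"
        using add[of 0 s t] pos[of s t] pos1 by (simp add: divide_strict_right_mono)
    qed
    show "E 0 0 / E 0 1 = 0" using add[of 0 0 0] by simp
    show "dist (\<sigma> s) (\<sigma> t) \<le> E 0 1 * (E 0 t / E 0 1 - E 0 s / E 0 1)"
      if "0 \<le> s" "s \<le> t" "t \<le> 1" for s t
    proof -
      have "E 0 1 * (E 0 t / E 0 1 - E 0 s / E 0 1) = E 0 t - E 0 s"
        using pos1 by (simp add: right_diff_distrib)
      then show ?thesis using dist_le[OF that] add[of 0 s t] that by simp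
    qed
  qed (use pos1 in auto)
qed

section \<open>Finiteness, additivity and minimality from the triangle inequality\<close>

locale spacetime =
  fixes l :: "'a::metric_space \<Rightarrow> 'a \<Rightarrow> ereal"
  assumes metric_spacetime: "metric_spacetime l"
begin

lemma l_refl: "l x x \<le> 0"
  using metric_spacetime by (auto simp: metric_spacetime_def)

lemma l_cases: "l x y \<le> 0 \<or> l x y = \<infinity>"
  using metric_spacetime by (auto simp: metric_spacetime_def)

lemma l_triangle: "l x y \<le> 0 \<Longrightarrow> l y z \<le> 0 \<Longrightarrow> l x z \<le> l x y + l y z"
  using metric_spacetime unfolding metric_spacetime_def
  by (metis ereal_infty_less(1) ereal_infty_less_eq(1) max_less_iff_conj zero_ereal_def PInfty_neq_ereal(1))

lemma l_trans: "l x y \<le> 0 \<Longrightarrow> l y z \<le> 0 \<Longrightarrow> l x z \<le> 0"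
  using l_triangle[of x y z] by (metis add_nonpos_nonpos order_trans)

text \<open>The value -\<infinity> propagates outwards: adding the nonpositive separations from
  \<open>p\<close> and to \<open>q\<close> cannot cancel it.\<close>

lemma finite_between:
  assumes "\<bar>l p q\<bar> \<noteq> \<infinity>" "l p u \<le> 0" "l u v \<le> 0" "l v q \<le> 0"
  shows "\<bar>l u v\<bar> \<noteq> \<infinity>"
proof
  assume "\<bar>l u v\<bar> = \<infinity>"
  with assms(3) have uv: "l u v = -\<infinity>" by (cases "l u v") auto
  have "l p v \<le> l p u + l u v" by (rule l_triangle) fact+
  then have "l p v = -\<infinity>" using uv assms(2) by (cases "l p u") auto
  moreover have "l p q \<le> l p v + l v q" by (rule l_triangle) (use \<open>l p v = -\<infinity>\<close> assms in auto)
  ultimately have "l p q = -\<infinity>" using assms(4) by (cases "l v q") auto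
  then show False using assms(1) by simp
qed

text \<open>The triangle inequality for \<open>x\<close>, \<open>x\<close>, \<open>x\<close> leaves
  only the values 0 and -\<infinity>.\<close>

lemma l_self_eq_0:
  assumes "\<bar>l x x\<bar> \<noteq> \<infinity>" shows "l x x = 0"
proof -
  have "l x x \<le> l x x + l x x" using l_triangle l_refl by blast
  then show ?thesis using assms l_refl[of x] by (cases "l x x") auto
qed

lemma causal_path_le:
  "causal_path l {a..b} \<sigma> \<Longrightarrow> a \<le> s \<Longrightarrow> s \<le> t \<Longrightarrow> t \<le> b \<Longrightarrow> l (\<sigma> s) (\<sigma> t) \<le> 0"
  using l_refl[of "\<sigma> t"] by (cases "s = t") (simp_all add: causal_path_def)

lemma causal_path_image_subset_J:
  assumes "causal_path l {a..b} \<sigma>" "l p (\<sigma> a) \<le> 0" "l (\<sigma> b) q \<le> 0"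
  shows "\<sigma> ` {a..b} \<subseteq> J l {p} {q}"
proof clarify
  fix t assume t: "t \<in> {a..b}"
  then have "l (\<sigma> a) (\<sigma> t) \<le> 0" "l (\<sigma> t) (\<sigma> b) \<le> 0"
    by (auto intro: causal_path_le[OF assms(1)])
  then have "l p (\<sigma> t) \<le> 0" "l (\<sigma> t) q \<le> 0"
    using assms(2,3) by (blast intro: l_trans)+
  then show "\<sigma> t \<in> J l {p} {q}" by (simp add: J_def)
qed

text \<open>Dropping nonpositive terms from the triangle inequality bounds each inner separation
  below by that of the endpoints, which is 0.\<close>

lemma lightlike_pathI:
  assumes c: "causal_path l {a..b} \<sigma>" and "l (\<sigma> a) (\<sigma> b) = 0"
  shows "lightlike_path l {a..b} \<sigma>"
  unfolding lightlike_path_def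
proof (intro conjI ballI impI)
  fix s t assume st: "s \<in> {a..b}" "t \<in> {a..b}" "s < t"
  have le: "l (\<sigma> a) (\<sigma> s) \<le> 0" "l (\<sigma> s) (\<sigma> t) \<le> 0" "l (\<sigma> t) (\<sigma> b) \<le> 0"
    using st by (auto intro: causal_path_le[OF c])
  have "0 \<le> l (\<sigma> a) (\<sigma> t) + l (\<sigma> t) (\<sigma> b)"
    using l_triangle[of "\<sigma> a" "\<sigma> t" "\<sigma> b"] le l_trans assms(2) by metis
  also have "\<dots> \<le> l (\<sigma> a) (\<sigma> t) + 0" by (rule add_left_mono) fact
  also have "\<dots> \<le> l (\<sigma> a) (\<sigma> s) + l (\<sigma> s) (\<sigma> t)" using l_triangle le by simp
  also have "\<dots> \<le> 0 + l (\<sigma> s) (\<sigma> t)" by (rule add_right_mono) fact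
  finally show "l (\<sigma> s) (\<sigma> t) = 0" using le(2) by simp
qed (simp add: is_interval_cc)

text \<open>For a curve no longer than the separation of its endpoints this reverses the triangle
  inequality, so \<open>l\<close> becomes additive along the curve.\<close>

lemma L_time_ge_three:
  assumes "a \<le> s" "s \<le> t" "t \<le> b"
  shows "l (\<sigma> a) (\<sigma> s) + l (\<sigma> s) (\<sigma> t) + l (\<sigma> t) (\<sigma> b) \<le> L_time l a b \<sigma>"
proof -
  define p where "p = (\<lambda>i::nat. if i = 0 then a else if i = 1 then s else if i = 2 then t else b)"
  have "(\<Sum>i<3. l (\<sigma> (p i)) (\<sigma> (p (Suc i)))) \<le> L_time l (p 0) (p 3) \<sigma>"
    by (rule path_length_ge_weak) (use assms l_refl in \<open>auto simp: p_def\<close>)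
  then show ?thesis by (simp add: p_def eval_nat_numeral)
qed

lemma L_time_ge_ends:
  assumes "a \<le> b" shows "l (\<sigma> a) (\<sigma> b) \<le> L_time l a b \<sigma>"
proof -
  define p where "p = (\<lambda>i::nat. if i = 0 then a else b)"
  have "(\<Sum>i<Suc 0. l (\<sigma> (p i)) (\<sigma> (p (Suc i)))) \<le> L_time l (p 0) (p (Suc 0)) \<sigma>"
  proof (rule path_length_ge_weak)
    show "p i \<le> p (Suc i)" for i using assms by (simp add: p_def)
    show "l (\<sigma> (p i)) (\<sigma> (p i)) \<le> 0" for i by (rule l_refl)
  qed
  then show ?thesis by (simp add: p_def)
qed

text \<open>The partition without inner points shows that no competitor is shorter than the
  separation of the common endpoints.\<close>

lemma minimizing_if_L_time_le:
  assumes "causal_curve l {a..b} \<sigma>" "L_time l a b \<sigma> \<le> l (\<sigma> a) (\<sigma> b)"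
  shows "l_minimizing l a b \<sigma>"
  unfolding l_minimizing_def
proof (intro conjI allI impI)
  fix c d \<tau> assume \<tau>: "causal_curve l {c..d} \<tau> \<and> \<tau> c = \<sigma> a \<and> \<tau> d = \<sigma> b"
  then have "c < d" by (blast intro: causal_curve_imp_less)
  then have "l (\<tau> c) (\<tau> d) \<le> L_time l c d \<tau>" by (intro L_time_ge_ends less_imp_le)
  with \<tau> assms(2) show "L_time l a b \<sigma> \<le> L_time l c d \<tau>" by (metis order_trans)
qed fact

text \<open>The degenerate case \<open>p = q\<close> is covered by a constant map, so chains may
  repeat points. Additivity is stated as an inequality of extended reals because no finiteness is
  available here.\<close>

lemma segment_exists:
  assumes "l p q \<le> 0"
    and "p \<noteq> q \<Longrightarrow> \<exists>\<sigma>. l_curve l \<sigma> \<and> \<sigma> 0 = p \<and> \<sigma> 1 = q"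
  shows "\<exists>(\<rho> :: real \<Rightarrow> 'a) C. \<rho> 0 = p \<and> \<rho> 1 = q \<and> C-lipschitz_on {0..1} \<rho> \<and>
     (\<forall>s t. 0 \<le> s \<and> s \<le> t \<and> t \<le> 1 \<longrightarrow> l (\<rho> s) (\<rho> t) \<le> 0 \<and>
        l p (\<rho> s) + l (\<rho> s) (\<rho> t) + l (\<rho> t) q \<le> l p q)"
proof (cases "p = q")
  case True
  have "l q q + l q q + l q q \<le> 0 + 0 + l q q"
    by (intro add_mono l_refl order_refl)
  then show ?thesis using True l_refl[of q]
    by (intro exI[of _ "\<lambda>_. q"] exI[of _ 0] conjI allI impI)
      (simp_all add: lipschitz_on_constant)
next
  case False
  then obtain \<rho> where \<rho>: "l_curve l \<rho>" "\<rho> 0 = p" "\<rho> 1 = q" using assms(2) by blast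
  then have c: "causal_path l {0..1} \<rho>" "locally_lipschitz_on {0..1} \<rho>"
    and L: "L_time l 0 1 \<rho> = l p q"
    by (auto simp: l_curve_def causal_curve_def)
  obtain C where "C-lipschitz_on {0..1} \<rho>" using c(2) by (rule locally_lipschitz_on_compact)
  moreover have "l (\<rho> s) (\<rho> t) \<le> 0 \<and> l p (\<rho> s) + l (\<rho> s) (\<rho> t) + l (\<rho> t) q \<le> l p q"
    if "0 \<le> s \<and> s \<le> t \<and> t \<le> 1" for s t
    using causal_path_le[OF c(1), of s t] L_time_ge_three[of 0 s t 1 \<rho>] that L \<rho>(2,3) by simp
  ultimately show ?thesis using \<rho>(2,3) by blast
qed

end

section \<open>Polygons of geodesics through causal chains\<close>

locale geodesic_spacetime = spacetime +
  assumes geodesic: "l p q \<le> 0 \<Longrightarrow> p \<noteq> q \<Longrightarrow> \<exists>\<sigma>. l_curve l \<sigma> \<and> \<sigma> 0 = p \<and> \<sigma> 1 = q"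
    and globally_hyperbolic: "K_globally_hyperbolic l"
    and regular: "regular_spacetime l"
    and continuous: "continuous_on UNIV (neg_part l)"
begin

text \<open>The polygon runs through its \<open>i\<close>-th edge on the parameter interval from
  \<open>i\<close> to \<open>i + 1\<close>. The chain is infinite to avoid a last index; finite
  chains are padded by repeating their final point.\<close>

lemma causal_chain_interpolation:
  assumes "\<And>i. l (x i) (x (Suc i)) \<le> 0"
  obtains \<tau> where "\<And>i. \<tau> (real i) = x i"
    and "\<And>N. causal_path l {0..real N} \<tau>"
    and "\<And>N. \<exists>C. C-lipschitz_on {0..real N} \<tau>"
    and "\<And>i s t. real i \<le> s \<Longrightarrow> s \<le> t \<Longrightarrow> t \<le> real (Suc i) \<Longrightarrow>
           l (x i) (\<tau> s) + l (\<tau> s) (\<tau> t) + l (\<tau> t) (x (Suc i)) \<le> l (x i) (x (Suc i))"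
proof -
  have "\<forall>i. \<exists>(\<rho> :: real \<Rightarrow> 'a) C. \<rho> 0 = x i \<and> \<rho> 1 = x (Suc i) \<and> C-lipschitz_on {0..1} \<rho> \<and>
     (\<forall>s t. 0 \<le> s \<and> s \<le> t \<and> t \<le> 1 \<longrightarrow> l (\<rho> s) (\<rho> t) \<le> 0 \<and>
        l (x i) (\<rho> s) + l (\<rho> s) (\<rho> t) + l (\<rho> t) (x (Suc i)) \<le> l (x i) (x (Suc i)))"
    by (intro allI segment_exists assms geodesic)
  from choice[OF this] obtain \<rho> :: "nat \<Rightarrow> real \<Rightarrow> 'a" where "\<forall>i. \<exists>C. \<rho> i 0 = x i \<and> \<rho> i 1 = x (Suc i) \<and>
     C-lipschitz_on {0..1} (\<rho> i) \<and>
     (\<forall>s t. 0 \<le> s \<and> s \<le> t \<and> t \<le> 1 \<longrightarrow> l (\<rho> i s) (\<rho> i t) \<le> 0 \<and>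
        l (x i) (\<rho> i s) + l (\<rho> i s) (\<rho> i t) + l (\<rho> i t) (x (Suc i)) \<le> l (x i) (x (Suc i)))" ..
  from choice[OF this] obtain C where \<rho>:
    "\<And>i. \<rho> i 0 = x i" "\<And>i. \<rho> i 1 = x (Suc i)" "\<And>i. (C i)-lipschitz_on {0..1} (\<rho> i)"
    "\<And>i s t. 0 \<le> s \<Longrightarrow> s \<le> t \<Longrightarrow> t \<le> 1 \<Longrightarrow> l (\<rho> i s) (\<rho> i t) \<le> 0"
    "\<And>i s t. 0 \<le> s \<Longrightarrow> s \<le> t \<Longrightarrow> t \<le> 1 \<Longrightarrow>
        l (x i) (\<rho> i s) + l (\<rho> i s) (\<rho> i t) + l (\<rho> i t) (x (Suc i)) \<le> l (x i) (x (Suc i))"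
    by auto
  \<comment> \<open>At an integer the floor selects the edge that starts there; \<open>piece\<close>
    shows that the edge ending there has the same value.\<close>
  define \<tau> where "\<tau> t = \<rho> (nat \<lfloor>t\<rfloor>) (t - real (nat \<lfloor>t\<rfloor>))" for t :: real
  have piece: "\<tau> t = \<rho> i (t - real i)" if "real i \<le> t" "t \<le> real (Suc i)" for i t
  proof (cases "t = real (Suc i)")
    case True
    then have "nat \<lfloor>t\<rfloor> = Suc i" by (simp add: nat_add_distrib)
    then show ?thesis using True \<rho>(1,2) by (simp add: \<tau>_def)
  next
    case False
    then have "\<lfloor>t\<rfloor> = int i" using that by (intro floor_unique) auto
    then show ?thesis by (simp add: \<tau>_def)
  qed
  show ?thesis
  proof (rule that[of \<tau>])
    show "\<tau> (real i) = x i" for i using piece[of i "real i"] \<rho>(1) by simp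
    show "causal_path l {0..real N} \<tau>" for N
    proof (rule causal_pathI)
      fix s t assume st: "0 \<le> s" "s < t" "t \<le> real N"
      show "l (\<tau> s) (\<tau> t) \<le> 0"
      proof (rule transitive_on_unit_pieces[where N = N and R = "\<lambda>s t. l (\<tau> s) (\<tau> t) \<le> 0"])
        show "l (\<tau> s) (\<tau> t) \<le> 0" if "real i \<le> s" "s \<le> t" "t \<le> real (Suc i)" for i s t
          using that piece[of i s] piece[of i t] \<rho>(4)[of "s - real i" "t - real i" i] by simp
        show "l (\<tau> s) (\<tau> u) \<le> 0" if "l (\<tau> s) (\<tau> t) \<le> 0" "l (\<tau> t) (\<tau> u) \<le> 0" for s t u
          using that by (rule l_trans)
        show "0 < N" using st by (intro gr0I) auto
      qed (use st in auto)
    qed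
    show "\<exists>D. D-lipschitz_on {0..real N} \<tau>" for N
    proof (cases "N = 0")
      case True
      then show ?thesis by (auto intro!: exI[of _ 0] lipschitz_on_singleton)
    next
      case False
      \<comment> \<open>The sum dominates each of the nonnegative constants \<open>C i\<close> of
        the first \<open>N\<close> edges.\<close>
      define D where "D = (\<Sum>i<N. C i)"
      have Cnn: "0 \<le> C i" for i using \<rho>(3) lipschitz_on_nonneg by blast
      have CD: "C i \<le> D" if "i < N" for i
        unfolding D_def by (rule member_le_sum) (use that Cnn in auto)
      have "D-lipschitz_on {0..real N} \<tau>"
      proof (rule lipschitz_on_leI)
        show "0 \<le> D" using Cnn by (auto simp: D_def intro: sum_nonneg)
        fix s t assume st: "s \<in> {0..real N}" "t \<in> {0..real N}" "s \<le> t"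
        have "dist (\<tau> s) (\<tau> t) \<le> D * (t - s)"
        proof (rule transitive_on_unit_pieces[where N = N and
              R = "\<lambda>s t. dist (\<tau> s) (\<tau> t) \<le> D * (t - s)"])
          fix s t u assume "dist (\<tau> s) (\<tau> t) \<le> D * (t - s)" "dist (\<tau> t) (\<tau> u) \<le> D * (u - t)"
          then show "dist (\<tau> s) (\<tau> u) \<le> D * (u - s)"
            using dist_triangle[of "\<tau> s" "\<tau> u" "\<tau> t"] by (simp add: algebra_simps)
        next
          fix i s t assume i: "i < N" "real i \<le> s" "s \<le> t" "t \<le> real (Suc i)"
          then have "dist (\<tau> s) (\<tau> t) \<le> C i * dist (s - real i) (t - real i)"
            using piece[of i s] piece[of i t] lipschitz_onD[OF \<rho>(3)[of i]] by simp
          also have "\<dots> = C i * (t - s)" using i by (simp add: dist_real_def)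
          also have "\<dots> \<le> D * (t - s)" using CD i by (intro mult_right_mono) auto
          finally show "dist (\<tau> s) (\<tau> t) \<le> D * (t - s)" .
        qed (use st False in auto)
        then show "dist (\<tau> s) (\<tau> t) \<le> D * dist s t" using st by (simp add: dist_real_def)
      qed
      then show ?thesis ..
    qed
    show "l (x i) (\<tau> s) + l (\<tau> s) (\<tau> t) + l (\<tau> t) (x (Suc i)) \<le> l (x i) (x (Suc i))"
      if "real i \<le> s" "s \<le> t" "t \<le> real (Suc i)" for i s t
      using that piece[of i s] piece[of i t] \<rho>(5)[of "s - real i" "t - real i" i] by simp
  qed
qed

section \<open>Length bounds and antisymmetry from global hyperbolicity\<close>

lemma compact_J: "compact X \<Longrightarrow> compact Y \<Longrightarrow> compact (J l X Y)"
  using globally_hyperbolic by (auto simp: K_globally_hyperbolic_def)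

lemma causal_chain_length_bounded:
  obtains C where "\<And>x N. (\<And>i. l (x i) (x (Suc i)) \<le> 0) \<Longrightarrow> l p (x 0) \<le> 0 \<Longrightarrow> l (x N) q \<le> 0 \<Longrightarrow>
     (\<Sum>i<N. dist (x i) (x (Suc i))) \<le> C"
proof -
  have "compact (J l {p} {q})" by (intro compact_J) auto
  then obtain C where C: "\<And>a b \<sigma>. causal_curve l {a..b} \<sigma> \<Longrightarrow> \<sigma> ` {a..b} \<subseteq> J l {p} {q} \<Longrightarrow>
      L_dist a b \<sigma> \<le> ereal C"
    using globally_hyperbolic unfolding K_globally_hyperbolic_def non_totally_imprisoning_def
    by metis
  \<comment> \<open>A constant polygon is not a causal curve, so \<open>C\<close> does not apply to
    it and might be negative; its vertex sum is 0, which accounts for the maximum.\<close>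
  show ?thesis
  proof (rule that[of "max C 0"])
    fix x N
    assume x: "\<And>i. l (x i) (x (Suc i)) \<le> 0" "l p (x 0) \<le> 0" "l (x N) q \<le> 0"
    obtain \<tau> where \<tau>: "\<And>i. \<tau> (real i) = x i" "causal_path l {0..real N} \<tau>"
      "\<exists>D. D-lipschitz_on {0..real N} \<tau>"
      using causal_chain_interpolation[of x, OF x(1)] by metis
    show "(\<Sum>i<N. dist (x i) (x (Suc i))) \<le> max C 0"
    proof (cases "\<tau> constant_on {0..real N}")
      case True
      then obtain y where "\<And>t. t \<in> {0..real N} \<Longrightarrow> \<tau> t = y" by (auto simp: constant_on_def)
      then have "x i = y" if "i \<le> N" for i using \<tau>(1)[of i] that by force
      then have "(\<Sum>i<N. dist (x i) (x (Suc i))) = 0" by (intro sum.neutral) auto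
      then show ?thesis by simp
    next
      case False
      then have "causal_curve l {0..real N} \<tau>"
        using \<tau> lipschitz_imp_locally_lipschitz by (auto simp: causal_curve_def)
      moreover have "\<tau> ` {0..real N} \<subseteq> J l {p} {q}"
        using \<tau>(1)[of 0] \<tau>(1)[of N] x by (intro causal_path_image_subset_J \<tau>(2)) auto
      ultimately have "L_dist 0 (real N) \<tau> \<le> ereal C" by (rule C)
      moreover have "(\<Sum>i<N. ereal (dist (\<tau> (real i)) (\<tau> (real (Suc i))))) \<le> L_dist 0 (real N) \<tau>"
        by (rule path_length_ge) auto
      ultimately have "ereal (\<Sum>i<N. dist (x i) (x (Suc i))) \<le> ereal C"
        unfolding \<tau>(1) sum_ereal by (rule order_trans[rotated])
      then show ?thesis by simp
    qed
  qed
qed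

text \<open>Otherwise the chain \<open>p\<close>, \<open>q\<close>, \<open>p\<close>,
  \<open>q\<close>, ... would zigzag for ever, and its \<open>d\<close>-length would exceed the
  uniform bound for chains from \<open>p\<close> back to \<open>p\<close>.\<close>

lemma l_antisym:
  assumes "l p q \<le> 0" "l q p \<le> 0" shows "p = q"
proof (rule ccontr)
  assume "p \<noteq> q"
  define x where "x i = (if even i then p else q)" for i :: nat
  obtain C where C: "\<And>x N. (\<And>i. l (x i) (x (Suc i)) \<le> 0) \<Longrightarrow> l p (x 0) \<le> 0 \<Longrightarrow> l (x N) p \<le> 0 \<Longrightarrow>
     (\<Sum>i<N. dist (x i) (x (Suc i))) \<le> C"
    using causal_chain_length_bounded[of p p] by blast
  have "(\<Sum>i<N. dist (x i) (x (Suc i))) \<le> C" for N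
    by (rule C) (use assms l_refl[of p] in \<open>auto simp: x_def\<close>)
  moreover have "(\<Sum>i<N. dist (x i) (x (Suc i))) = real N * dist p q" for N
  proof -
    have "(\<Sum>i<N. dist (x i) (x (Suc i))) = (\<Sum>i<N. dist p q)"
      by (rule sum.cong) (auto simp: x_def dist_commute)
    then show ?thesis by simp
  qed
  ultimately have "real N * dist p q \<le> C" for N by metis
  moreover obtain N where "C < real N * dist p q"
    using reals_Archimedean3[of "dist p q"] \<open>p \<noteq> q\<close> by auto
  ultimately show False by (meson not_le)
qed

section \<open>Regularity applied to null segments\<close>

text \<open>Telescoping the potential \<open>h\<close> bounds the length by the separation of the
  endpoints, so the curve is minimizing. The hypothesis takes this form because both polygons and
  given minimizers come with such a potential.\<close>

lemma null_segment_constant: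
  assumes \<sigma>: "causal_curve l {a..b} \<sigma>"
    and h: "\<And>s t. a \<le> s \<Longrightarrow> s \<le> t \<Longrightarrow> t \<le> b \<Longrightarrow> l (\<sigma> s) (\<sigma> t) \<le> ereal (h t - h s)"
      "ereal (h b - h a) \<le> l (\<sigma> a) (\<sigma> b)"
    and "l (\<sigma> a) (\<sigma> b) < 0"
    and st: "a \<le> s" "s < t" "t \<le> b" "l (\<sigma> s) (\<sigma> t) = 0"
  shows "\<sigma> constant_on {s..t}"
proof -
  have ab: "a < b" using \<sigma> by (rule causal_curve_imp_less)
  have causal: "causal_path l {a..b} \<sigma>" using \<sigma> by (simp add: causal_curve_def)
  \<comment> \<open>Regularity is formulated over \<open>{0..1}\<close>; an affine change of
    parameter preserves causality and the Lipschitz property.\<close>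
  define \<zeta> where "\<zeta> u = \<sigma> (a + u * (b - a))" for u
  have \<zeta>: "\<zeta> ((r - a) / (b - a)) = \<sigma> r" for r using ab by (simp add: \<zeta>_def)
  have aff: "a \<le> a + u * (b - a)" "a + u * (b - a) \<le> b" "a + u * (b - a) \<le> a + v * (b - a)"
    if "0 \<le> u" "u \<le> v" "v \<le> 1" for u v
  proof -
    have "u * (b - a) \<le> v * (b - a)" "v * (b - a) \<le> 1 * (b - a)" "0 \<le> u * (b - a)"
      using that ab by (intro mult_right_mono mult_nonneg_nonneg; simp)+
    then show "a \<le> a + u * (b - a)" "a + u * (b - a) \<le> b" "a + u * (b - a) \<le> a + v * (b - a)"
      by auto
  qed
  have "causal_path l {0..1} \<zeta>"
    unfolding \<zeta>_def by (intro causal_pathI causal_path_le[OF causal] aff) auto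
  moreover have "\<not> \<zeta> constant_on {0..1}"
  proof
    assume "\<zeta> constant_on {0..1}"
    then obtain y where y: "\<And>u. u \<in> {0..1} \<Longrightarrow> \<zeta> u = y" by (auto simp: constant_on_def)
    have "\<sigma> r = y" if "r \<in> {a..b}" for r
      using y[of "(r - a) / (b - a)"] \<zeta>[of r] that ab by (simp add: field_simps)
    then show False using \<sigma> by (auto simp: causal_curve_def constant_on_def)
  qed
  moreover have "locally_lipschitz_on {0..1} \<zeta>"
  proof -
    have "locally_lipschitz_on {a..b} \<sigma>" using \<sigma> by (simp add: causal_curve_def)
    then obtain C where C: "C-lipschitz_on {a..b} \<sigma>" by (rule locally_lipschitz_on_compact)
    have "(C * (b - a))-lipschitz_on {0..1} \<zeta>"
    proof (rule lipschitz_on_leI)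
      show "0 \<le> C * (b - a)" using lipschitz_on_nonneg[OF C] ab by simp
      fix u v :: real assume uv: "u \<in> {0..1}" "v \<in> {0..1}" "u \<le> v"
      have "dist (\<zeta> u) (\<zeta> v) \<le> C * dist (a + u * (b - a)) (a + v * (b - a))"
        unfolding \<zeta>_def using aff[of u u] aff[of v v] uv by (intro lipschitz_onD[OF C]) auto
      also have "dist (a + u * (b - a)) (a + v * (b - a)) = dist u v * (b - a)"
        using ab by (simp add: dist_real_def flip: left_diff_distrib) (simp add: abs_mult)
      finally show "dist (\<zeta> u) (\<zeta> v) \<le> C * (b - a) * dist u v" by (simp add: mult_ac)
    qed
    then show ?thesis by (rule lipschitz_imp_locally_lipschitz)
  qed
  ultimately have curve: "causal_curve l {0..1} \<zeta>" by (simp add: causal_curve_def)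
  have "L_time l 0 1 \<zeta> \<le> ereal (h (a + 1 * (b - a)) - h (a + 0 * (b - a)))"
    by (rule path_length_le_telescope) (unfold \<zeta>_def, intro h(1) aff, auto)
  then have "L_time l 0 1 \<zeta> \<le> l (\<zeta> 0) (\<zeta> 1)" using h(2) by (simp add: \<zeta>_def)
  with curve have "l_minimizing l 0 1 \<zeta>" by (rule minimizing_if_L_time_le)
  moreover have "l (\<zeta> 0) (\<zeta> 1) < 0" using assms(4) by (simp add: \<zeta>_def)
  ultimately have reg: "\<zeta> constant_on {u..v}"
    if "0 \<le> u" "u < v" "v \<le> 1" "lightlike_path l {u..v} \<zeta>" for u v
    using regular that unfolding regular_spacetime_def by blast
  define u v where "u = (s - a) / (b - a)" and "v = (t - a) / (b - a)"
  have uv: "0 \<le> u" "u < v" "v \<le> 1"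
    using st ab by (auto simp: u_def v_def divide_strict_right_mono)
  have "lightlike_path l {u..v} \<zeta>"
  proof (rule lightlike_pathI)
    show "causal_path l {u..v} \<zeta>"
      unfolding \<zeta>_def using uv by (intro causal_pathI causal_path_le[OF causal] aff) auto
    show "l (\<zeta> u) (\<zeta> v) = 0" using st by (simp add: u_def v_def \<zeta>)
  qed
  then have "\<zeta> constant_on {u..v}" by (rule reg[OF uv])
  then obtain y where y: "\<And>w. w \<in> {u..v} \<Longrightarrow> \<zeta> w = y"
    unfolding constant_on_def by blast
  have "\<sigma> r = y" if "r \<in> {s..t}" for r
    using y[of "(r - a) / (b - a)"] \<zeta>[of r] that ab
    by (simp add: u_def v_def divide_right_mono)
  then show ?thesis by (auto simp: constant_on_def)
qed

text \<open>If \<open>x\<close> and \<open>y\<close> differed, the polygon \<open>p\<close>,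
  \<open>x\<close>, \<open>y\<close>, \<open>q\<close> would be a minimizer with a nonconstant null
  edge in the middle. Only four points enter, so nothing is assumed about a path through
  them.\<close>

lemma no_null_link:
  assumes pq: "\<bar>l p q\<bar> \<noteq> \<infinity>" "l p q < 0"
    and le: "l p x \<le> 0" "l x y = 0" "l y q \<le> 0"
    and sum: "l p x + l y q \<le> l p q"
  shows "x = y"
proof (rule ccontr)
  assume "x \<noteq> y"
  \<comment> \<open>Between \<open>p\<close> and \<open>q\<close> all separations are finite, so the
    computation moves to real numbers, where terms can be cancelled.\<close>
  define f where "f u v = real_of_ereal (l u v)" for u v
  have f: "l u v = ereal (f u v)" if "l p u \<le> 0" "l u v \<le> 0" "l v q \<le> 0" for u v
    using finite_between[OF pq(1) that] by (auto simp: f_def ereal_real)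
  have tri: "f u w \<le> f u v + f v w" if "l p u \<le> 0" "l u v \<le> 0" "l v w \<le> 0" "l w q \<le> 0" for u v w
  proof -
    have "l p v \<le> 0" "l u w \<le> 0" "l v q \<le> 0" using that l_trans by blast+
    then show ?thesis using l_triangle[of u v w] f[of u w] f[of u v] f[of v w] that by simp
  qed
  have nonpos: "f u v \<le> 0" if "l u v \<le> 0" for u v
    using that by (cases "l u v") (auto simp: f_def)
  have le': "l x y \<le> 0" "l p y \<le> 0" "l x q \<le> 0" "l p q \<le> 0"
    using le l_trans[of p x y] l_trans[of x y q] pq by auto
  \<comment> \<open>After three edges the chain stays at \<open>q\<close>; the edge over
    \<open>{1..2}\<close> is the one from \<open>x\<close> to \<open>y\<close>.\<close>
  define z where "z i = (if i = 0 then p else if i = 1 then x else if i = 2 then y else q)" for i :: nat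
  have z: "z 0 = p" "z 1 = x" "z 2 = y" "z 3 = q" by (auto simp: z_def)
  have "l (z i) (z (Suc i)) \<le> 0" for i
    using le le' l_refl[of q] by (auto simp: z_def)
  from causal_chain_interpolation[of z, OF this] obtain \<tau> where \<tau>: "\<And>i. \<tau> (real i) = z i"
    "causal_path l {0..real 3} \<tau>" "\<exists>C. C-lipschitz_on {0..real 3} \<tau>"
    and piece: "\<And>i s t. real i \<le> s \<Longrightarrow> s \<le> t \<Longrightarrow> t \<le> real (Suc i) \<Longrightarrow>
           l (z i) (\<tau> s) + l (\<tau> s) (\<tau> t) + l (\<tau> t) (z (Suc i)) \<le> l (z i) (z (Suc i))"
    by metis
  have \<tau>z: "\<tau> 0 = p" "\<tau> 1 = x" "\<tau> 2 = y" "\<tau> 3 = q"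
    using \<tau>(1)[of 0] \<tau>(1)[of 1] \<tau>(1)[of 2] \<tau>(1)[of 3] z by auto
  have \<tau>le: "l (\<tau> s) (\<tau> t) \<le> 0" if "0 \<le> s" "s \<le> t" "t \<le> 3" for s t
    by (rule causal_path_le[OF \<tau>(2)]) (use that in auto)
  have p\<tau>: "l p (\<tau> s) \<le> 0" "l (\<tau> s) q \<le> 0" if "0 \<le> s" "s \<le> 3" for s
    using \<tau>le[of 0 s] \<tau>le[of s 3] that \<tau>z by auto
  have zadd: "f p (z i) + f (z i) (z (Suc i)) + f (z (Suc i)) q \<le> f p q" if "i < 3" for i
  proof -
    have *: "f p x + f y q \<le> f p q"
      using sum f[of p x] f[of y q] f[of p q] le le' l_refl[of p] l_refl[of q] by simp
    have "f x y = 0" using le by (simp add: f_def)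
    moreover have "f x q \<le> f x y + f y q" using le le' l_refl[of q] by (intro tri) auto
    moreover have "f p y \<le> f p x + f x y" using le le' l_refl[of p] by (intro tri) auto
    moreover have "f p p \<le> 0" "f q q \<le> 0" using nonpos l_refl by auto
    moreover have "i = 0 \<or> i = 1 \<or> i = 2" using that by auto
    ultimately show ?thesis using * by (auto simp: z_def)
  qed
  \<comment> \<open>This makes \<open>f p\<close> a potential for the polygon. Within one edge, the
    route from \<open>p\<close> along that edge to \<open>q\<close> costs at most
    \<open>f p q\<close> by \<open>zadd\<close>, which leaves no slack in the triangle inequalities
    on either side.\<close>
  have add: "f p (\<tau> s) + f (\<tau> s) (\<tau> t) \<le> f p (\<tau> t)" if "0 \<le> s" "s \<le> t" "t \<le> 3" for s t
  proof (rule transitive_on_unit_pieces[where N = 3 and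
        R = "\<lambda>s t. f p (\<tau> s) + f (\<tau> s) (\<tau> t) \<le> f p (\<tau> t)"])
    fix s t u assume *: "0 \<le> s" "s \<le> t" "t \<le> u" "u \<le> real 3"
      "f p (\<tau> s) + f (\<tau> s) (\<tau> t) \<le> f p (\<tau> t)" "f p (\<tau> t) + f (\<tau> t) (\<tau> u) \<le> f p (\<tau> u)"
    have "f (\<tau> s) (\<tau> u) \<le> f (\<tau> s) (\<tau> t) + f (\<tau> t) (\<tau> u)"
      using * by (intro tri p\<tau> \<tau>le) auto
    then show "f p (\<tau> s) + f (\<tau> s) (\<tau> u) \<le> f p (\<tau> u)" using * by linarith
  next
    fix i :: nat and s t assume i: "i < 3" "real i \<le> s" "s \<le> t" "t \<le> real (Suc i)"
    have st: "0 \<le> s" "t \<le> 3" "0 \<le> t" "s \<le> 3" using i by auto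
    have zi: "l p (z i) \<le> 0" "l (z i) q \<le> 0" "l p (z (Suc i)) \<le> 0" "l (z (Suc i)) q \<le> 0"
      using p\<tau>[of "real i"] p\<tau>[of "real (Suc i)"] i(1) unfolding \<tau>(1) by auto
    have z\<tau>: "l (z i) (\<tau> s) \<le> 0" "l (\<tau> t) (z (Suc i)) \<le> 0" "l (z i) (z (Suc i)) \<le> 0"
      using \<tau>le[of "real i" s] \<tau>le[of t "real (Suc i)"] \<tau>le[of "real i" "real (Suc i)"] i
      unfolding \<tau>(1) by auto
    have "f (z i) (\<tau> s) + f (\<tau> s) (\<tau> t) + f (\<tau> t) (z (Suc i)) \<le> f (z i) (z (Suc i))"
      using piece[OF i(2-4)] f[of "z i" "\<tau> s"] f[of "\<tau> s" "\<tau> t"] f[of "\<tau> t" "z (Suc i)"]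
        f[of "z i" "z (Suc i)"] zi z\<tau> p\<tau>[of s] p\<tau>[of t] \<tau>le[of s t] st i(3) by simp
    moreover have "f p (\<tau> s) \<le> f p (z i) + f (z i) (\<tau> s)"
      by (intro tri l_refl zi z\<tau> p\<tau> st)
    moreover have "f p q \<le> f p (\<tau> t) + f (\<tau> t) q"
      by (intro tri l_refl p\<tau> st)
    moreover have "f (\<tau> t) q \<le> f (\<tau> t) (z (Suc i)) + f (z (Suc i)) q"
      by (intro tri l_refl p\<tau> zi z\<tau> st)
    ultimately show "f p (\<tau> s) + f (\<tau> s) (\<tau> t) \<le> f p (\<tau> t)" using zadd[OF i(1)] by linarith
  qed (use that in auto)
  have nonconstant: "\<not> \<tau> constant_on {s..t}" if "s \<le> 1" "2 \<le> t" for s t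
  proof
    assume "\<tau> constant_on {s..t}"
    then obtain c where "\<And>r. r \<in> {s..t} \<Longrightarrow> \<tau> r = c" unfolding constant_on_def by blast
    from this[of 1] this[of 2] show False using \<tau>z \<open>x \<noteq> y\<close> that by simp
  qed
  have "locally_lipschitz_on {0..3} \<tau>"
    using \<tau>(3) lipschitz_imp_locally_lipschitz by auto
  then have curve: "causal_curve l {0..3} \<tau>"
    using \<tau>(2) nonconstant by (simp add: causal_curve_def)
  have "\<tau> constant_on {1..2}"
  proof (rule null_segment_constant[OF curve, of "\<lambda>t. f p (\<tau> t)"])
    show "l (\<tau> s) (\<tau> t) \<le> ereal (f p (\<tau> t) - f p (\<tau> s))" if "0 \<le> s" "s \<le> t" "t \<le> 3" for s t
      using add[OF that] f[of "\<tau> s" "\<tau> t"] p\<tau>[of s] p\<tau>[of t] \<tau>le[of s t] that by simp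
    have "f p p = 0" using f[OF l_refl l_refl le'(4)] l_self_eq_0[of p] by (cases "l p p") auto
    then show "ereal (f p (\<tau> 3) - f p (\<tau> 0)) \<le> l (\<tau> 0) (\<tau> 3)"
      using f[of p q] l_refl le'(4) by (simp add: \<tau>z)
  qed (use \<tau>z le pq in auto)
  then show False using nonconstant by simp
qed

section \<open>From minimizing curves to \<open>l\<close>-paths\<close>

text \<open>The limit determines \<open>l x y\<close> only once the pair is known to be causal,
  since null and unrelated pairs both give 0.\<close>

lemma tendsto_neg_part:
  assumes "(u \<longlongrightarrow> x) F" "(v \<longlongrightarrow> y) F"
  shows "((\<lambda>n. max (- l (u n) (v n)) 0) \<longlongrightarrow> max (- l x y) 0) F"
proof -
  have "((\<lambda>n. neg_part l (u n, v n)) \<longlongrightarrow> neg_part l (x, y)) F"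
    by (rule continuous_on_tendsto_compose[OF continuous tendsto_Pair[OF assms]]) auto
  then show ?thesis by (simp add: neg_part_def)
qed

text \<open>On a closed causal curve every point would lie both before and after the common
  endpoint, and antisymmetry would make the curve constant.\<close>

lemma causal_curve_endpoints_neq:
  assumes "causal_curve l {a..b} \<sigma>" shows "\<sigma> a \<noteq> \<sigma> b"
proof
  assume eq: "\<sigma> a = \<sigma> b"
  have c: "causal_path l {a..b} \<sigma>" using assms by (simp add: causal_curve_def)
  have "\<sigma> t = \<sigma> b" if "t \<in> {a..b}" for t
  proof (rule l_antisym)
    show "l (\<sigma> t) (\<sigma> b) \<le> 0" using that by (intro causal_path_le[OF c]) auto
    show "l (\<sigma> b) (\<sigma> t) \<le> 0" unfolding eq[symmetric] using that by (intro causal_path_le[OF c]) auto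
  qed
  then have "\<sigma> constant_on {a..b}" unfolding constant_on_def by blast
  then show False using assms by (simp add: causal_curve_def)
qed

text \<open>A point with \<open>l p p < 0\<close> is isolated: by continuity its neighbours lie both in its
  future and in its past.\<close>

lemma causal_curve_l_self:
  assumes \<sigma>: "causal_curve l {a..b} \<sigma>" and t: "t \<in> {a..b}"
  shows "l (\<sigma> t) (\<sigma> t) = 0"
proof (rule ccontr)
  define p where "p = \<sigma> t"
  assume "l (\<sigma> t) (\<sigma> t) \<noteq> 0"
  then have neg: "l p p < 0" using l_refl[of p] by (simp add: p_def)
  define U where "U = {q. 0 < neg_part l (p, q)} \<inter> {q. 0 < neg_part l (q, p)}"
  have "open U" unfolding U_def
    by (intro open_Int open_Collect_less continuous_on_const
        continuous_on_compose2[OF continuous] continuous_intros) auto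
  have "\<And>q. q \<in> U \<Longrightarrow> q = p"
    by (rule l_antisym) (auto simp: U_def neg_part_def less_max_iff_disj ereal_less_uminus_reorder less_imp_le)
  moreover have "p \<in> U" using neg by (auto simp: U_def neg_part_def less_max_iff_disj ereal_less_uminus_reorder)
  ultimately have "U = {p}" by blast
  have "connected (\<sigma> ` {a..b})"
    using causal_curve_continuous[OF \<sigma>] by (intro connected_continuous_image) auto
  moreover have "openin (top_of_set (\<sigma> ` {a..b})) {p}"
    unfolding openin_open using \<open>open U\<close> \<open>U = {p}\<close> t by (intro exI[of _ U]) (auto simp: p_def)
  moreover have "closedin (top_of_set (\<sigma> ` {a..b})) {p}"
    unfolding closedin_closed using t by (intro exI[of _ "{p}"]) (auto simp: p_def)
  ultimately have "{p} = \<sigma> ` {a..b}" unfolding connected_clopen by blast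
  then have "\<sigma> constant_on {a..b}" unfolding constant_on_def by blast
  then show False using \<sigma> by (simp add: causal_curve_def)
qed

text \<open>An \<open>l\<close>-curve with the same endpoints is a competitor whose length is
  exactly their separation.\<close>

lemma minimizing_L_time:
  assumes "l_minimizing l a b \<sigma>"
  shows "L_time l a b \<sigma> \<le> l (\<sigma> a) (\<sigma> b)"
proof -
  have \<sigma>: "causal_curve l {a..b} \<sigma>" using assms by (simp add: l_minimizing_def)
  have "l (\<sigma> a) (\<sigma> b) \<le> 0"
    using \<sigma> causal_curve_imp_less[OF \<sigma>] by (intro causal_path_le[of a b]) (auto simp: causal_curve_def)
  then obtain \<tau> where \<tau>: "l_curve l \<tau>" "\<tau> 0 = \<sigma> a" "\<tau> 1 = \<sigma> b"
    using geodesic causal_curve_endpoints_neq[OF \<sigma>] by blast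
  then have "L_time l a b \<sigma> \<le> L_time l 0 1 \<tau>"
    using assms unfolding l_minimizing_def l_curve_def by blast
  then show ?thesis using \<tau> by (simp add: l_curve_def)
qed

text \<open>Otherwise the partitions into \<open>n\<close> equal parts each have a step of time separation
  \<open>-\<infinity>\<close>, and these steps shrink to a point \<open>p\<close> of the curve, where \<open>l p p = -\<infinity>\<close>.\<close>

lemma minimizing_finite:
  assumes "l_minimizing l a b \<sigma>"
  shows "\<bar>l (\<sigma> a) (\<sigma> b)\<bar> \<noteq> \<infinity>"
proof
  assume inf: "\<bar>l (\<sigma> a) (\<sigma> b)\<bar> = \<infinity>"
  have \<sigma>: "causal_curve l {a..b} \<sigma>" using assms by (simp add: l_minimizing_def)
  then have ab: "a < b" by (rule causal_curve_imp_less)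
  have c: "causal_path l {a..b} \<sigma>" using \<sigma> by (simp add: causal_curve_def)
  have "l (\<sigma> a) (\<sigma> b) \<le> 0" using ab by (intro causal_path_le[OF c]) auto
  then have "l (\<sigma> a) (\<sigma> b) = -\<infinity>" using inf by (cases "l (\<sigma> a) (\<sigma> b)") auto
  then have L: "L_time l a b \<sigma> = -\<infinity>" using minimizing_L_time[OF assms] by simp
  have "\<exists>s. a \<le> s \<and> s + (b - a) / Suc n \<le> b \<and> l (\<sigma> s) (\<sigma> (s + (b - a) / Suc n)) = -\<infinity>" for n
  proof -
    define e where "e = (b - a) / Suc n"
    have e: "0 < e" "a + Suc n * e = b" using ab by (auto simp: e_def)
    define p where "p i = a + real i * e" for i
    have pS: "p (Suc i) = p i + e" for i by (simp add: p_def algebra_simps)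
    have "(\<Sum>i<Suc n. l (\<sigma> (p i)) (\<sigma> (p (Suc i)))) \<le> L_time l a b \<sigma>"
      by (rule path_length_ge) (use e pS in \<open>auto simp: p_def\<close>)
    then have "(\<Sum>i<Suc n. l (\<sigma> (p i)) (\<sigma> (p (Suc i)))) = -\<infinity>"
      unfolding L ereal_infty_less_eq .
    \<comment> \<open>\<open>sum_Inf\<close> detects an infinite summand without its sign; causality
      then rules out the value \<infinity>.\<close>
    then have "\<bar>\<Sum>i<Suc n. l (\<sigma> (p i)) (\<sigma> (p (Suc i)))\<bar> = \<infinity>"
      by (rule ssubst) simp
    then obtain i where i: "i < Suc n" "\<bar>l (\<sigma> (p i)) (\<sigma> (p (Suc i)))\<bar> = \<infinity>"
      unfolding sum_Inf by auto
    have "real (Suc i) * e \<le> real (Suc n) * e" using i e by (intro mult_right_mono) auto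
    then have p: "a \<le> p i" "p i + e \<le> b" using e unfolding pS[symmetric] by (auto simp: p_def)
    have "l (\<sigma> (p i)) (\<sigma> (p i + e)) \<le> 0"
      by (rule causal_path_le[OF c]) (use p e in auto)
    then have "l (\<sigma> (p i)) (\<sigma> (p i + e)) = -\<infinity>"
      using i(2) unfolding pS by (cases "l (\<sigma> (p i)) (\<sigma> (p i + e))") auto
    then show ?thesis using p unfolding e_def by blast
  qed
  then obtain s where s: "\<And>n. a \<le> s n" "\<And>n. s n + (b - a) / Suc n \<le> b"
    "\<And>n. l (\<sigma> (s n)) (\<sigma> (s n + (b - a) / Suc n)) = -\<infinity>"
    by metis
  have pos: "0 \<le> (b - a) / Suc n" for n using ab by simp
  have "s n \<in> {a..b}" for n using s(1)[of n] s(2)[of n] pos[of n] by simp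
  then obtain r z where r: "z \<in> {a..b}" "strict_mono r" "(s \<circ> r) \<longlonglongrightarrow> z"
    using compact_imp_seq_compact[OF compact_Icc, of a b] unfolding seq_compact_def by metis
  have "(\<lambda>n. (b - a) * inverse (real (Suc n))) \<longlonglongrightarrow> (b - a) * 0"
    by (intro tendsto_mult tendsto_const LIMSEQ_inverse_real_of_nat)
  from LIMSEQ_subseq_LIMSEQ[OF this r(2)]
  have "(\<lambda>n. (s \<circ> r) n + (b - a) / Suc (r n)) \<longlonglongrightarrow> z + (b - a) * 0"
    by (intro tendsto_add r(3)) (simp add: o_def divide_inverse)
  then have t: "(\<lambda>n. s (r n) + (b - a) / Suc (r n)) \<longlonglongrightarrow> z" by simp
  have cont: "continuous_on {a..b} \<sigma>" using \<sigma> by (rule causal_curve_continuous)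
  have "(\<lambda>n. \<sigma> (s (r n))) \<longlonglongrightarrow> \<sigma> z"
    using continuous_on_tendsto_compose[OF cont r(3) r(1)] \<open>\<And>n. s n \<in> {a..b}\<close> by (simp add: o_def)
  moreover have "(\<lambda>n. \<sigma> (s (r n) + (b - a) / Suc (r n))) \<longlonglongrightarrow> \<sigma> z"
  proof (rule continuous_on_tendsto_compose[OF cont t r(1)], intro always_eventually allI)
    show "s (r n) + (b - a) / Suc (r n) \<in> {a..b}" for n
      using s(1)[of "r n"] s(2)[of "r n"] pos[of "r n"] by (auto intro: add_increasing2)
  qed
  ultimately have "(\<lambda>n. max (- l (\<sigma> (s (r n))) (\<sigma> (s (r n) + (b - a) / Suc (r n)))) 0)
      \<longlonglongrightarrow> max (- l (\<sigma> z) (\<sigma> z)) 0"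
    by (rule tendsto_neg_part)
  then have "(\<lambda>n::nat. \<infinity>::ereal) \<longlonglongrightarrow> 0"
    unfolding s(3) causal_curve_l_self[OF \<sigma> r(1)] by simp
  then show False using LIMSEQ_const_iff[of "\<infinity>::ereal" 0] by simp
qed

lemma minimizing_imp_l_path:
  assumes min: "l_minimizing l a b \<sigma>" and neg: "l (\<sigma> a) (\<sigma> b) < 0"
  obtains \<phi> \<gamma> where "reparameterizes \<phi> a b \<sigma> 0 1 \<gamma>" "l_path l \<gamma>"
proof -
  have \<sigma>: "causal_curve l {a..b} \<sigma>" using min by (simp add: l_minimizing_def)
  then have ab: "a < b" by (rule causal_curve_imp_less)
  have c: "causal_path l {a..b} \<sigma>" using \<sigma> by (simp add: causal_curve_def)
  note le = causal_path_le[OF c]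
  define f where "f s t = real_of_ereal (l (\<sigma> s) (\<sigma> t))" for s t
  have f: "l (\<sigma> s) (\<sigma> t) = ereal (f s t)" if "a \<le> s" "s \<le> t" "t \<le> b" for s t
    unfolding f_def
    by (rule ereal_real'[symmetric], rule finite_between[OF minimizing_finite[OF min]])
      (use that in \<open>auto intro: le\<close>)
  define T where "T = - f a b"
  have T: "l (\<sigma> a) (\<sigma> b) = ereal (- T)" "0 < T" using f[of a b] neg ab by (auto simp: T_def)
  have tri: "f s u \<le> f s t + f t u" if "a \<le> s" "s \<le> t" "t \<le> u" "u \<le> b" for s t u
    using l_triangle[of "\<sigma> s" "\<sigma> t" "\<sigma> u"] f[of s t] f[of t u] f[of s u] le[of s t] le[of t u] that
    by simp
  have add: "f s t = f a t - f a s" if st: "a \<le> s" "s \<le> t" "t \<le> b" for s t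
  proof -
    have "f a s + f s t + f t b \<le> f a b"
      using L_time_ge_three[OF st, of \<sigma>] minimizing_L_time[OF min] st
        f[of a s] f[of s t] f[of t b] f[of a b] by (auto dest: order_trans)
    then show ?thesis using tri[of a t b] tri[of a s t] st by simp
  qed
  have nonpos: "f s t \<le> 0" if "a \<le> s" "s \<le> t" "t \<le> b" for s t
    using f[OF that] le[OF that] by simp
  define \<phi> where "\<phi> t = - f a t / T" for t
  have \<phi>0: "\<phi> a = 0" and \<phi>1: "\<phi> b = 1"
    using add[of a a] ab T by (auto simp: \<phi>_def T_def)
  have \<phi>_mono: "\<phi> s \<le> \<phi> t" if "a \<le> s" "s \<le> t" "t \<le> b" for s t
    using add[OF that] nonpos[OF that] T by (simp add: \<phi>_def divide_right_mono)
  have "continuous_on {a..b} (\<lambda>t. - f a t)"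
    unfolding continuous_on
  proof
    fix t assume t: "t \<in> {a..b}"
    have "(\<sigma> \<longlongrightarrow> \<sigma> t) (at t within {a..b})"
      using causal_curve_continuous[OF \<sigma>] t by (simp add: continuous_on)
    then have "((\<lambda>u. max (- l (\<sigma> a) (\<sigma> u)) 0) \<longlongrightarrow> max (- l (\<sigma> a) (\<sigma> t)) 0) (at t within {a..b})"
      by (intro tendsto_neg_part tendsto_const)
    \<comment> \<open>Along the curve all separations from the starting point are finite and
      nonpositive, so the negative part is a real number here and convergence descends from extended
      reals to reals.\<close>
    moreover have eq: "max (- l (\<sigma> a) (\<sigma> u)) 0 = ereal (- f a u)" if "u \<in> {a..b}" for u
      using f[of a u] nonpos[of a u] that by (simp add: max_def zero_ereal_def)
    moreover have "\<forall>\<^sub>F u in at t within {a..b}. max (- l (\<sigma> a) (\<sigma> u)) 0 = ereal (- f a u)"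
      unfolding eventually_at_topological using eq by auto
    ultimately have "((\<lambda>u. ereal (- f a u)) \<longlongrightarrow> ereal (- f a t)) (at t within {a..b})"
      using t by (simp add: filterlim_cong[OF refl refl])
    then show "((\<lambda>u. - f a u) \<longlongrightarrow> - f a t) (at t within {a..b})" by (simp only: lim_ereal)
  qed
  then have cont: "continuous_on {a..b} \<phi>"
    unfolding \<phi>_def using T by (intro continuous_on_divide continuous_on_const) auto
  have surj: "\<phi> ` {a..b} = {0..1}"
  proof
    show "\<phi> ` {a..b} \<subseteq> {0..1}"
      using \<phi>_mono[of a] \<phi>_mono[of _ b] \<phi>0 \<phi>1 by fastforce
    show "{0..1} \<subseteq> \<phi> ` {a..b}"
    proof
      fix y :: real assume "y \<in> {0..1}"
      then have "\<exists>x\<ge>a. x \<le> b \<and> \<phi> x = y"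
        using IVT'[of \<phi> a y b] \<phi>0 \<phi>1 ab cont by auto
      then show "y \<in> \<phi> ` {a..b}" by auto
    qed
  qed
  \<comment> \<open>\<open>\<phi>\<close> need not be injective, so this picks some parameter in
    each fibre; by \<open>fibre\<close> the curve takes the same value at any other choice.\<close>
  define \<psi> where "\<psi> = inv_into {a..b} \<phi>"
  have \<psi>: "a \<le> \<psi> u" "\<psi> u \<le> b" "\<phi> (\<psi> u) = u" if "0 \<le> u" "u \<le> 1" for u
    using inv_into_into[of u \<phi> "{a..b}"] f_inv_into_f[of u \<phi> "{a..b}"] that surj by (auto simp: \<psi>_def)
  have fibre: "\<sigma> s = \<sigma> t" if st: "a \<le> s" "s \<le> t" "t \<le> b" "\<phi> s = \<phi> t" for s t
  proof (cases "s = t")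
    case False
    have "l (\<sigma> s) (\<sigma> t) = 0"
      using st f[of s t] add[of s t] T by (simp add: \<phi>_def)
    have "\<sigma> constant_on {s..t}"
    proof (rule null_segment_constant[OF \<sigma>, of "f a"])
      show "l (\<sigma> u) (\<sigma> v) \<le> ereal (f a v - f a u)" if "a \<le> u" "u \<le> v" "v \<le> b" for u v
        using f[OF that] add[OF that] by simp
      show "ereal (f a b - f a a) \<le> l (\<sigma> a) (\<sigma> b)" using f[of a b] add[of a b] ab by simp
    qed (use False st neg \<open>l (\<sigma> s) (\<sigma> t) = 0\<close> in auto)
    then show ?thesis using st by (auto simp: constant_on_def)
  qed simp
  define \<gamma> where "\<gamma> = \<sigma> \<circ> \<psi>"
  have \<gamma>: "\<sigma> t = \<gamma> (\<phi> t)" if t: "a \<le> t" "t \<le> b" for t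
  proof -
    have "\<phi> t \<in> {0..1}" using surj t by auto
    then have "a \<le> \<psi> (\<phi> t)" "\<psi> (\<phi> t) \<le> b" "\<phi> (\<psi> (\<phi> t)) = \<phi> t" using \<psi>[of "\<phi> t"] by auto
    then have "\<sigma> t = \<sigma> (\<psi> (\<phi> t))"
      using fibre[of t "\<psi> (\<phi> t)"] fibre[of "\<psi> (\<phi> t)" t] t linear by metis
    then show ?thesis by (simp add: \<gamma>_def)
  qed
  have "reparameterizes \<phi> a b \<sigma> 0 1 \<gamma>"
    using cont surj \<gamma> \<phi>_mono by (auto simp: reparameterizes_def mono_on_def)
  moreover have "l_path l \<gamma>"
  proof -
    have ends: "l (\<gamma> 0) (\<gamma> 1) = ereal (- T)"
      using \<gamma>[of a] \<gamma>[of b] \<phi>0 \<phi>1 ab T by simp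
    have "l (\<gamma> u) (\<gamma> v) = ereal ((v - u) * - T)" if uv: "0 \<le> u" "u < v" "v \<le> 1" for u v
    proof -
      have less: "\<psi> u < \<psi> v"
        using \<phi>_mono[of "\<psi> v" "\<psi> u"] \<psi>[of u] \<psi>[of v] uv by force
      then have "f (\<psi> u) (\<psi> v) = f a (\<psi> v) - f a (\<psi> u)"
        using \<psi> uv by (intro add) auto
      also have "\<dots> = (\<phi> (\<psi> v) - \<phi> (\<psi> u)) * - T" using T by (simp add: \<phi>_def field_simps)
      also have "\<dots> = (v - u) * - T" using \<psi> uv by simp
      finally show ?thesis using f[of "\<psi> u" "\<psi> v"] less \<psi>[of u] \<psi>[of v] uv by (simp add: \<gamma>_def)
    qed
    then show ?thesis unfolding l_path_def ends using T by simp
  qed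
  ultimately show ?thesis by (rule that)
qed

section \<open>From \<open>l\<close>-paths to minimizing \<open>l\<close>-curves\<close>

text \<open>A limit point \<open>x\<close> of values at parameters tending to \<open>t\<close> has
  the same separation from one endpoint as \<open>\<sigma> t\<close>, by continuity of the negative
  part. With \<open>x\<close> and \<open>\<sigma> t\<close> causally related, the triangle
  inequality then makes them null related.\<close>

lemma l_path_continuous:
  assumes c: "l (\<sigma> 0) (\<sigma> 1) = ereal c" "c < 0"
    and l_eq: "\<And>s t. 0 \<le> s \<Longrightarrow> s \<le> t \<Longrightarrow> t \<le> 1 \<Longrightarrow> l (\<sigma> s) (\<sigma> t) = ereal ((t - s) * c)"
  shows "continuous_on {0..1} \<sigma>"
proof (rule ccontr)
  have le: "l (\<sigma> s) (\<sigma> t) \<le> 0" if "0 \<le> s" "s \<le> t" "t \<le> 1" for s t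
    using l_eq[OF that] that c by (simp add: mult_nonneg_nonpos)
  have neg: "max (- l p q) 0 = - l p q" if "l p q \<le> 0" for p q
    using that by (simp add: max_absorb1 ereal_0_le_uminus_iff)
  assume "\<not> continuous_on {0..1} \<sigma>"
  then obtain t e where t: "t \<in> {0..1}" and e: "e > 0"
    and "\<And>d. d > 0 \<Longrightarrow> \<exists>u\<in>{0..1}. dist u t < d \<and> \<not> dist (\<sigma> u) (\<sigma> t) < e"
    unfolding continuous_on_iff by metis
  then have "\<forall>n. \<exists>u. u \<in> {0..1} \<and> dist u t < inverse (real (Suc n)) \<and> \<not> dist (\<sigma> u) (\<sigma> t) < e"
    by (metis inverse_positive_iff_positive of_nat_0_less_iff zero_less_Suc)
  then obtain u where u: "\<And>n. u n \<in> {0..1}" "\<And>n. dist (u n) t < inverse (real (Suc n))"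
    "\<And>n. \<not> dist (\<sigma> (u n)) (\<sigma> t) < e"
    by metis
  have "(\<lambda>n. dist (u n) t) \<longlonglongrightarrow> 0"
    by (rule tendsto_sandwich[OF _ _ tendsto_const LIMSEQ_inverse_real_of_nat];
        intro always_eventually allI less_imp_le[OF u(2)] zero_le_dist)
  then have "u \<longlonglongrightarrow> t" by (simp add: tendsto_dist_iff[of u])
  \<comment> \<open>\<open>K\<close> is compact and contains the range of \<open>\<sigma>\<close>, so limit points are causally related to \<open>\<sigma> t\<close>.\<close>
  define K where "K = J l {\<sigma> 0} {\<sigma> t} \<union> J l {\<sigma> t} {\<sigma> 1}"
  have "compact K" unfolding K_def by (intro compact_Un compact_J) auto
  have "\<sigma> (u n) \<in> K" for n
    using u(1)[of n] t le[of 0 "u n"] le[of "u n" t] le[of t "u n"] le[of "u n" 1]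
    by (cases "u n \<le> t") (simp_all add: K_def J_def)
  then obtain r x where r: "x \<in> K" "strict_mono r" "((\<lambda>n. \<sigma> (u n)) \<circ> r) \<longlonglongrightarrow> x"
    using seq_compactE[OF compact_imp_seq_compact[OF \<open>compact K\<close>], of "\<lambda>n. \<sigma> (u n)"] by blast
  then have \<sigma>r: "(\<lambda>n. \<sigma> (u (r n))) \<longlonglongrightarrow> x" by (simp add: o_def)
  have ur: "(\<lambda>n. u (r n)) \<longlonglongrightarrow> t"
    using LIMSEQ_subseq_LIMSEQ[OF \<open>u \<longlonglongrightarrow> t\<close> r(2)] by (simp add: o_def)
  have "e \<le> dist x (\<sigma> t)"
    by (rule tendsto_lowerbound[OF tendsto_dist[OF \<sigma>r tendsto_const]])
      (use u(3) in \<open>auto simp: not_less\<close>)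
  then have "x \<noteq> \<sigma> t" using e by auto
  moreover have "x = \<sigma> t"
  proof (cases "x \<in> J l {\<sigma> 0} {\<sigma> t}")
    case True
    then have x: "l (\<sigma> 0) x \<le> 0" "l x (\<sigma> t) \<le> 0" by (auto simp: J_def)
    have "(\<lambda>n. max (- l (\<sigma> 0) (\<sigma> (u (r n)))) 0) \<longlonglongrightarrow> max (- l (\<sigma> 0) x) 0"
      by (intro tendsto_neg_part tendsto_const \<sigma>r)
    moreover have "max (- l (\<sigma> 0) (\<sigma> (u (r n)))) 0 = ereal (- (u (r n) * c))" for n
      using u(1)[of "r n"] l_eq[of 0 "u (r n)"] le[of 0 "u (r n)"] by (simp add: neg)
    moreover have "(\<lambda>n. ereal (- (u (r n) * c))) \<longlonglongrightarrow> ereal (- (t * c))"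
      unfolding lim_ereal by (intro tendsto_intros ur)
    ultimately have "max (- l (\<sigma> 0) x) 0 = ereal (- (t * c))"
      by (simp only: LIMSEQ_unique)
    then have 0: "l (\<sigma> 0) x = ereal (t * c)"
      using x(1) by (cases "l (\<sigma> 0) x") (auto simp: neg)
    have "ereal (t * c) \<le> ereal (t * c) + l x (\<sigma> t)"
      using l_triangle[OF x] l_eq[of 0 t] t 0 by simp
    then have "l x (\<sigma> t) = 0"
      using x(2) by (cases "l x (\<sigma> t)") (auto simp: zero_ereal_def)
    then show ?thesis
      \<comment> \<open>The sum condition holds with equality: \<open>t * c\<close> up to
        \<open>x\<close> and \<open>(1 - t) * c\<close> from \<open>\<sigma> t\<close> on add up to
        \<open>c\<close>.\<close>
      by (rule no_null_link[of "\<sigma> 0" "\<sigma> 1", rotated 3])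
        (use c x 0 t l_eq[of t 1] le[of t 1] in \<open>auto simp: algebra_simps\<close>)
  next
    case False
    then have x: "l (\<sigma> t) x \<le> 0" "l x (\<sigma> 1) \<le> 0" using r(1) by (auto simp: J_def K_def)
    \<comment> \<open>Time-reversed argument: \<open>x\<close> now lies in the future of
      \<open>\<sigma> t\<close>, so separations to \<open>\<sigma> 1\<close> are compared.\<close>
    have "(\<lambda>n. max (- l (\<sigma> (u (r n))) (\<sigma> 1)) 0) \<longlonglongrightarrow> max (- l x (\<sigma> 1)) 0"
      by (intro tendsto_neg_part tendsto_const \<sigma>r)
    moreover have "max (- l (\<sigma> (u (r n))) (\<sigma> 1)) 0 = ereal (- ((1 - u (r n)) * c))" for n
      using u(1)[of "r n"] l_eq[of "u (r n)" 1] le[of "u (r n)" 1] by (simp add: neg)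
    moreover have "(\<lambda>n. ereal (- ((1 - u (r n)) * c))) \<longlonglongrightarrow> ereal (- ((1 - t) * c))"
      unfolding lim_ereal by (intro tendsto_intros ur)
    ultimately have "max (- l x (\<sigma> 1)) 0 = ereal (- ((1 - t) * c))"
      by (simp only: LIMSEQ_unique)
    then have 0: "l x (\<sigma> 1) = ereal ((1 - t) * c)"
      using x(2) by (cases "l x (\<sigma> 1)") (auto simp: neg)
    have "ereal ((1 - t) * c) \<le> l (\<sigma> t) x + ereal ((1 - t) * c)"
      using l_triangle[OF x] l_eq[of t 1] t 0 by simp
    then have "l (\<sigma> t) x = 0"
      using x(1) by (cases "l (\<sigma> t) x") (auto simp: zero_ereal_def)
    then show ?thesis
      by (rule no_null_link[of "\<sigma> 0" "\<sigma> 1", rotated 3, symmetric])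
        (use c x 0 t l_eq[of 0 t] le[of 0 t] in \<open>auto simp: algebra_simps\<close>)
  qed
  ultimately show False by contradiction
qed

lemma l_path_imp_l_curve:
  assumes "l_path l \<sigma>"
  obtains \<phi> \<gamma> where "reparameterizes \<phi> 0 1 \<sigma> 0 1 \<gamma>" "strict_mono_on {0..1} \<phi>"
    "l_curve l \<gamma>" "l_minimizing l 0 1 \<gamma>"
proof -
  have path: "l (\<sigma> s) (\<sigma> t) = ereal (t - s) * l (\<sigma> 0) (\<sigma> 1)" "l (\<sigma> s) (\<sigma> t) \<notin> {0, \<infinity>, -\<infinity>}"
    if "0 \<le> s" "s < t" "t \<le> 1" for s t
    using assms that unfolding l_path_def by blast+
  obtain c where c: "l (\<sigma> 0) (\<sigma> 1) = ereal c" "c < 0"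
    using path(2)[of 0 1] l_cases[of "\<sigma> 0" "\<sigma> 1"] by (cases "l (\<sigma> 0) (\<sigma> 1)") auto
  have le: "l (\<sigma> s) (\<sigma> t) \<le> 0" if "0 \<le> s" "s \<le> t" "t \<le> 1" for s t
    using path[of s t] l_cases[of "\<sigma> s" "\<sigma> t"] l_refl[of "\<sigma> t"] that by (cases "s = t") auto
  have l_eq: "l (\<sigma> s) (\<sigma> t) = ereal ((t - s) * c)" if st: "0 \<le> s" "s \<le> t" "t \<le> 1" for s t
  proof (cases "s = t")
    case True
    \<comment> \<open>An \<open>l\<close>-path prescribes nothing on the diagonal; lying between
      endpoints of finite separation forces finiteness there, and hence the value 0.\<close>
    have "\<bar>l (\<sigma> t) (\<sigma> t)\<bar> \<noteq> \<infinity>"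
      by (rule finite_between[of "\<sigma> 0" "\<sigma> 1"]) (use c st in \<open>auto intro: le\<close>)
    then show ?thesis using True l_self_eq_0[of "\<sigma> t"] by (simp add: zero_ereal_def)
  next
    case False
    then show ?thesis using path(1)[of s t] st c by simp
  qed
  have cont: "continuous_on {0..1} \<sigma>" using c l_eq by (rule l_path_continuous)
  have inj: "inj_on \<sigma> {0..1}"
  proof (rule linorder_inj_onI)
    fix s t :: real assume st: "s < t" "s \<in> {0..1}" "t \<in> {0..1}"
    show "\<sigma> s \<noteq> \<sigma> t"
    proof
      assume "\<sigma> s = \<sigma> t"
      then have "ereal ((t - s) * c) = 0" using l_eq[of s t] l_eq[of t t] st by simp
      then show False using st c by simp
    qed
  qed auto
  obtain C where C: "\<And>x N. (\<And>i. l (x i) (x (Suc i)) \<le> 0) \<Longrightarrow> l (\<sigma> 0) (x 0) \<le> 0 \<Longrightarrow>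
     l (x N) (\<sigma> 1) \<le> 0 \<Longrightarrow> (\<Sum>i<N. dist (x i) (x (Suc i))) \<le> C"
    using causal_chain_length_bounded by blast
  have bound: "(\<Sum>i<N. dist (\<sigma> (s i)) (\<sigma> (s (Suc i)))) \<le> C"
    if s: "\<And>i. 0 \<le> s i \<and> s i \<le> s (Suc i) \<and> s i \<le> 1" for s N
    by (rule C[of "\<lambda>i. \<sigma> (s i)"]; rule le) (use s in auto)
  obtain \<phi> D where \<phi>: "continuous_on {0..1} \<phi>" "strict_mono_on {0..1} \<phi>" "\<phi> 0 = 0" "\<phi> 1 = 1"
    and D: "0 \<le> D" "\<And>s t. 0 \<le> s \<Longrightarrow> s \<le> t \<Longrightarrow> t \<le> 1 \<Longrightarrow> dist (\<sigma> s) (\<sigma> t) \<le> D * (\<phi> t - \<phi> s)"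
    using arclength_gauge[OF cont bound inj] by blast
  have mono: "mono_on {0..1} \<phi>" using \<phi>(2) by (rule strict_mono_on_imp_mono_on)
  have surj: "\<phi> ` {0..1} = {0..1}"
  proof
    show "\<phi> ` {0..1} \<subseteq> {0..1}"
      using mono_onD[OF mono, of 0] mono_onD[OF mono, of _ 1] \<phi> by fastforce
    show "{0..1} \<subseteq> \<phi> ` {0..1}"
    proof
      fix y :: real assume "y \<in> {0..1}"
      then have "\<exists>x\<ge>0. x \<le> 1 \<and> \<phi> x = y" using IVT'[of \<phi> 0 y 1] \<phi> by auto
      then show "y \<in> \<phi> ` {0..1}" by auto
    qed
  qed
  have \<phi>_inj: "inj_on \<phi> {0..1}" using \<phi>(2) by (rule strict_mono_on_imp_inj_on)
  define \<psi> where "\<psi> = inv_into {0..1} \<phi>"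
  have \<psi>: "0 \<le> \<psi> u" "\<psi> u \<le> 1" "\<phi> (\<psi> u) = u" if "0 \<le> u" "u \<le> 1" for u
    using inv_into_into[of u \<phi> "{0..1}"] f_inv_into_f[of u \<phi> "{0..1}"] that surj by (auto simp: \<psi>_def)
  have \<psi>\<phi>: "\<psi> (\<phi> t) = t" if "0 \<le> t" "t \<le> 1" for t
    using that inv_into_f_f[OF \<phi>_inj] by (simp add: \<psi>_def)
  have \<psi>_mono: "\<psi> u \<le> \<psi> v" if "0 \<le> u" "u \<le> v" "v \<le> 1" for u v
    using mono_onD[OF mono, of "\<psi> v" "\<psi> u"] \<psi>[of u] \<psi>[of v] that by force
  define \<gamma> where "\<gamma> = \<sigma> \<circ> \<psi>"
  have ends: "\<gamma> 0 = \<sigma> 0" "\<gamma> 1 = \<sigma> 1" using \<psi>\<phi>[of 0] \<psi>\<phi>[of 1] \<phi> by (auto simp: \<gamma>_def)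
  \<comment> \<open>The new parameter is no longer affine for \<open>l\<close>, but
    \<open>\<psi> u * c\<close> is a potential with exact increments, which is all that the length
    bound needs.\<close>
  have \<gamma>_eq: "l (\<gamma> u) (\<gamma> v) = ereal (\<psi> v * c - \<psi> u * c)" if "0 \<le> u" "u \<le> v" "v \<le> 1" for u v
    using l_eq[of "\<psi> u" "\<psi> v"] \<psi>_mono[OF that] \<psi>[of u] \<psi>[of v] that
    by (simp add: \<gamma>_def left_diff_distrib)
  have "D-lipschitz_on {0..1} \<gamma>"
  proof (rule lipschitz_on_leI)
    fix u v :: real assume uv: "u \<in> {0..1}" "v \<in> {0..1}" "u \<le> v"
    then have "dist (\<sigma> (\<psi> u)) (\<sigma> (\<psi> v)) \<le> D * (\<phi> (\<psi> v) - \<phi> (\<psi> u))"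
      by (intro D(2) \<psi>_mono) (auto simp: \<psi>)
    then show "dist (\<gamma> u) (\<gamma> v) \<le> D * dist u v"
      using uv by (simp add: \<gamma>_def \<psi> dist_real_def)
  qed fact
  moreover have "causal_path l {0..1} \<gamma>"
  proof (rule causal_pathI)
    fix u v :: real assume "0 \<le> u" "u < v" "v \<le> 1"
    then show "l (\<gamma> u) (\<gamma> v) \<le> 0"
      unfolding \<gamma>_def o_def by (intro le \<psi>_mono) (auto simp: \<psi>)
  qed
  moreover have "\<gamma> 0 \<noteq> \<gamma> 1" using inj_onD[OF inj, of 0 1] unfolding ends by auto
  then have "\<not> \<gamma> constant_on {0..1}" by (force simp: constant_on_def)
  ultimately have curve: "causal_curve l {0..1} \<gamma>"
    using lipschitz_imp_locally_lipschitz by (auto simp: causal_curve_def)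
  have "L_time l 0 1 \<gamma> \<le> ereal (\<psi> 1 * c - \<psi> 0 * c)"
    by (rule path_length_le_telescope[where h = "\<lambda>u. \<psi> u * c"]) (simp add: \<gamma>_eq)
  then have L: "L_time l 0 1 \<gamma> \<le> l (\<gamma> 0) (\<gamma> 1)" using \<gamma>_eq[of 0 1] by simp
  show ?thesis
  proof (rule that)
    show "reparameterizes \<phi> 0 1 \<sigma> 0 1 \<gamma>"
      using \<phi> mono surj \<psi>\<phi> by (auto simp: reparameterizes_def \<gamma>_def)
    show "l_curve l \<gamma>"
      using curve L L_time_ge_ends[of 0 1 \<gamma>] by (auto simp: l_curve_def)
    show "l_minimizing l 0 1 \<gamma>" using curve L by (rule minimizing_if_L_time_le)
  qed fact
qed

end

theorem corollary6:
  fixes l :: "'a::metric_space \<Rightarrow> 'a \<Rightarrow> ereal"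
  assumes "lorentzian_geodesic_space l"
    and "K_globally_hyperbolic l"
    and "regular_spacetime l"
    and "continuous_on UNIV (neg_part l)"
  shows "(\<forall>\<sigma>. l_path l \<sigma> \<longrightarrow>
            (\<exists>\<phi> \<gamma>. reparameterizes \<phi> 0 1 \<sigma> 0 1 \<gamma> \<and> strict_mono_on {0..1} \<phi> \<and>
                   l_curve l \<gamma> \<and> l_minimizing l 0 1 \<gamma>)) \<and>
         (\<forall>a b \<sigma>. l_minimizing l a b \<sigma> \<and> l (\<sigma> a) (\<sigma> b) < 0 \<longrightarrow>
            (\<exists>\<phi> \<gamma>. reparameterizes \<phi> a b \<sigma> 0 1 \<gamma> \<and> l_path l \<gamma>))"
proof -
  interpret geodesic_spacetime l
    using assms by unfold_locales (auto simp: lorentzian_geodesic_space_def)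
  show ?thesis
    using l_path_imp_l_curve minimizing_imp_l_path by metis
qed

end
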